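(* Let $\bar A\in\{0,\star\}^{n\times n}$ be symmetrically structured, let $\bar B\in\{0,\star\}^{n\times m}$ and $\bar B_{\mathcal U_{can}}\in\{0,\star\}^{n\times m'}$ be structured, and let $k\in\mathbb N$ be a budget. Then the greedy algorithm described in the context returns a $(1-1/e)$-approximation of the optimal solution of the Optimal Recovery Problem; that is, any set $\mathcal J\subseteq[m']$ it returns satisfies $|\mathcal J|\le k$ and $$\textrm{m-dim}\big(\bar A,[\bar B,\bar B_{\mathcal U_{can}}(\mathcal J)]\big)\ \ge\ \Big(1-\frac1e\Big)\max_{\mathcal J'\subseteq[m'],\ |\mathcal J'|\le k}\textrm{m-dim}\big(\bar A,[\bar B,\bar B_{\mathcal U_{can}}(\mathcal J')]\big).$$
   Context: A structured matrix $\bar M\in\{0,\star\}^{n\times m}$ is a matrix each of whose entries is either a fixed zero or an independent free real parameter $\star$. A matrix in $\{0,\star\}^{n\times n}$ is symmetrically structured if its pattern is symmetric and the free parameters at positions $(i,j)$ and $(j,i)$ are constrained to be equal. A numerical realization assigns real numbers to the $\star$-parameters. $[m']=\{1,\dots,m'\}$. For $\mathcal J\subseteq[m']$, $\bar B_{\mathcal U_{can}}(\mathcal J)$ is the matrix formed by the columns of $\bar B_{\mathcal U_{can}}$ indexed by $\mathcal J$, and $[\bar B,\bar B_{\mathcal U_{can}}(\mathcal J)]$ is the concatenation. For real $(A,B)$, the stabilizable subspace of $\dot x=Ax+Bu$ is the subspace of all initial states $x(0)\in\mathbb R^n$ for which there is a control input $u(t)$, $t\ge 0$, with $\lim_{t\to\infty}x(t)=\mathbf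 0$. $\textrm{m-dim}(\bar A,\bar B)$ is the maximum, over all numerical realizations $(\tilde A,\tilde B)$ of $(\bar A,\bar B)$, of the dimension of the stabilizable subspace of $(\tilde A,\tilde B)$. Optimal Recovery Problem: maximize $\textrm{m-dim}(\bar A,[\bar B,\bar B_{\mathcal U_{can}}(\mathcal J)])$ over $\mathcal J\subseteq[m']$ with $|\mathcal J|\le k$. Greedy algorithm: initialize $\mathcal J\leftarrow\emptyset$, $\mathcal L\leftarrow[m']$. Perform $k$ iterations (stopping earlier if $\mathcal L$ becomes empty); in each iteration compute $d_j=\textrm{m-dim}(\bar A,[\bar B,\bar B_{\mathcal U_{can}}(\mathcal J\cup\{j\})])$ for each $j\in\mathcal L$, pick any $j\in\mathcal L$ with $d_j=\max_{i\in\mathcal L}d_i$, and set $\mathcal J\leftarrow\mathcal J\cup\{j\}$, $\mathcal L\leftarrow\mathcal L\setminus\{j\}$. Return $\mathcal J$. *)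

theory Defs
  imports "HOL-Analysis.Analysis"
begin

datatype entry = Zero | Star

text \<open>
  The state space is \<open>real ^ 'n\<close>, and square matrices are indexed by \<open>'n\<close>.  Input matrices have
  a varying set of columns, so they are given as a finite set \<open>C\<close> of column indices together with
  a family of columns; an \<open>n\<close>-by-\<open>m\<close> matrix has \<open>C = {1..m}\<close> (with \<open>m = 0\<close> allowed), and the
  values of the family outside \<open>C\<close> are irrelevant.  The submatrix formed by the columns in \<open>J\<close> is
  the same family over the index set \<open>J\<close>, and the concatenation of \<open>(C, B)\<close> and \<open>(J, B')\<close> is
  \<open>(C <+> J, case_sum B B')\<close>.
\<close>

definition symmetrically_structured :: "entry ^ 'n ^ 'n \<Rightarrow> bool" where
  "symmetrically_structured A \<longleftrightarrow> transpose A = A"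

text \<open>
  In a symmetrically structured matrix the parameters at \<open>(i,j)\<close> and \<open>(j,i)\<close> coincide, whence the
  symmetry constraint on realizations.  A parameter may take any real value, including zero.
\<close>

definition sym_realization :: "entry ^ 'n ^ 'n \<Rightarrow> real ^ 'n ^ 'n \<Rightarrow> bool" where
  "sym_realization A A' \<longleftrightarrow>
     (\<forall>i j. A $ i $ j = Zero \<longrightarrow> A' $ i $ j = 0) \<and> (\<forall>i j. A' $ i $ j = A' $ j $ i)"

definition col_realization ::
    "'c set \<Rightarrow> ('c \<Rightarrow> entry ^ 'n) \<Rightarrow> ('c \<Rightarrow> real ^ 'n) \<Rightarrow> bool" where
  "col_realization C B B' \<longleftrightarrow> (\<forall>j\<in>C. \<forall>i. B j $ i = Zero \<longrightarrow> B' j $ i = 0)"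

definition trajectory ::
    "real ^ 'n ^ 'n \<Rightarrow> 'c set \<Rightarrow> ('c \<Rightarrow> real ^ 'n) \<Rightarrow> (real \<Rightarrow> 'c \<Rightarrow> real) \<Rightarrow> (real \<Rightarrow> real ^ 'n) \<Rightarrow> bool"
where
  "trajectory A C B u x \<longleftrightarrow>
     (\<forall>t\<ge>0. (x has_vector_derivative A *v x t + (\<Sum>j\<in>C. u t j *\<^sub>R B j)) (at t within {0..}))"

definition stabilizable_subspace ::
    "real ^ 'n ^ 'n \<Rightarrow> 'c set \<Rightarrow> ('c \<Rightarrow> real ^ 'n) \<Rightarrow> (real ^ 'n) set" where
  "stabilizable_subspace A C B =
     {x0. \<exists>u x. trajectory A C B u x \<and> x 0 = x0 \<and> (x \<longlongrightarrow> 0) at_top}"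

lemma subspace_stabilizable_subspace: "subspace (stabilizable_subspace A C B)"
proof (rule subspaceI)
  have "trajectory A C B (\<lambda>_ _. 0) (\<lambda>_. 0)"
    by (simp add: trajectory_def)
  then show "0 \<in> stabilizable_subspace A C B"
    unfolding stabilizable_subspace_def by fastforce
next
  fix a b
  assume "a \<in> stabilizable_subspace A C B" "b \<in> stabilizable_subspace A C B"
  then obtain u x v y
    where a: "trajectory A C B u x" "x 0 = a" "(x \<longlongrightarrow> 0) at_top"
      and b: "trajectory A C B v y" "y 0 = b" "(y \<longlongrightarrow> 0) at_top"
    unfolding stabilizable_subspace_def by blast
  have "trajectory A C B (\<lambda>t j. u t j + v t j) (\<lambda>t. x t + y t)"
    unfolding trajectory_def
  proof (intro allI impI)
    fix t :: real
    assume t: "0 \<le> t"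
    have "((\<lambda>t. x t + y t) has_vector_derivative
            (A *v x t + (\<Sum>j\<in>C. u t j *\<^sub>R B j)) + (A *v y t + (\<Sum>j\<in>C. v t j *\<^sub>R B j)))
          (at t within {0..})"
      using a(1) b(1) t unfolding trajectory_def by (intro has_vector_derivative_add) auto
    then show "((\<lambda>t. x t + y t) has_vector_derivative
            A *v (x t + y t) + (\<Sum>j\<in>C. (u t j + v t j) *\<^sub>R B j)) (at t within {0..})"
      by (simp add: matrix_vector_right_distrib scaleR_add_left sum.distrib add_ac)
  qed
  moreover have "((\<lambda>t. x t + y t) \<longlongrightarrow> 0) at_top"
    using tendsto_add[OF a(3) b(3)] by simp
  ultimately show "a + b \<in> stabilizable_subspace A C B"
    unfolding stabilizable_subspace_def using a(2) b(2)
    by (intro CollectI exI[of _ "\<lambda>t j. u t j + v t j"] exI[of _ "\<lambda>t. x t + y t"]) simp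
next
  fix c :: real and a
  assume "a \<in> stabilizable_subspace A C B"
  then obtain u x where a: "trajectory A C B u x" "x 0 = a" "(x \<longlongrightarrow> 0) at_top"
    unfolding stabilizable_subspace_def by blast
  have "trajectory A C B (\<lambda>t j. c * u t j) (\<lambda>t. c *\<^sub>R x t)"
    unfolding trajectory_def
  proof (intro allI impI)
    fix t :: real
    assume t: "0 \<le> t"
    have "((\<lambda>t. c *\<^sub>R x t) has_vector_derivative
            c *\<^sub>R (A *v x t + (\<Sum>j\<in>C. u t j *\<^sub>R B j))) (at t within {0..})"
      using a(1) t unfolding trajectory_def
      by (auto intro: bounded_linear.has_vector_derivative[OF bounded_linear_scaleR_right])
    then show "((\<lambda>t. c *\<^sub>R x t) has_vector_derivative
            A *v (c *\<^sub>R x t) + (\<Sum>j\<in>C. (c * u t j) *\<^sub>R B j)) (at t within {0..})"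
      by (simp add: scaleR_add_right scaleR_sum_right matrix_vector_mult_scaleR)
  qed
  moreover have "((\<lambda>t. c *\<^sub>R x t) \<longlongrightarrow> 0) at_top"
    using tendsto_scaleR[OF tendsto_const[of c] a(3)] by simp
  ultimately show "c *\<^sub>R a \<in> stabilizable_subspace A C B"
    unfolding stabilizable_subspace_def using a(2)
    by (intro CollectI exI[of _ "\<lambda>t j. c * u t j"] exI[of _ "\<lambda>t. c *\<^sub>R x t"]) simp
qed

text \<open>The maximum is over a set of dimensions that is nonempty and bounded by \<open>CARD('n)\<close>.\<close>

definition m_dim :: "entry ^ 'n ^ 'n \<Rightarrow> 'c set \<Rightarrow> ('c \<Rightarrow> entry ^ 'n) \<Rightarrow> nat" where
  "m_dim A C B =
     Max {dim (stabilizable_subspace A' C B') | A' B'.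
            sym_realization A A' \<and> col_realization C B B'}"

definition recovery_dim ::
    "entry ^ 'n ^ 'n \<Rightarrow> nat \<Rightarrow> (nat \<Rightarrow> entry ^ 'n) \<Rightarrow> (nat \<Rightarrow> entry ^ 'n) \<Rightarrow> nat set \<Rightarrow> nat" where
  "recovery_dim A m B Bcan J = m_dim A ({1..m} <+> J) (case_sum B Bcan)"

text \<open>
  \<open>greedy_state d V i J L\<close>: the greedy algorithm for the objective \<open>d\<close> on the ground set \<open>V\<close> can
  be in state \<open>(J, L)\<close> after \<open>i\<close> iterations; ties are broken arbitrarily.
\<close>

inductive greedy_state :: "(nat set \<Rightarrow> nat) \<Rightarrow> nat set \<Rightarrow> nat \<Rightarrow> nat set \<Rightarrow> nat set \<Rightarrow> bool"
  for d V where
  init: "greedy_state d V 0 {} V"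
| step: "greedy_state d V i J L \<Longrightarrow> j \<in> L \<Longrightarrow> d (J \<union> {j}) = Max ((\<lambda>l. d (J \<union> {l})) ` L) \<Longrightarrow>
         greedy_state d V (Suc i) (J \<union> {j}) (L - {j})"

definition greedy_returns :: "(nat set \<Rightarrow> nat) \<Rightarrow> nat set \<Rightarrow> nat \<Rightarrow> nat set \<Rightarrow> bool" where
  "greedy_returns d V k J \<longleftrightarrow>
     (\<exists>i L. greedy_state d V i J L \<and> (i = k \<or> i < k \<and> L = {}))"

end

theory Submission
  imports Defs
begin

text \<open>
  The objective is monotone and submodular, so the classical analysis of the greedy algorithm
  applies.  For a symmetric realization the stabilizable subspace lies in the column space of
  \<open>[A, B]\<close>, with equality if every eigenvector for a nonzero eigenvalue is seen by \<open>B\<close>.  On the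
  part of the graph that the inputs reach, a generic realization has this property (induction on
  the number of vertices), while the part \<open>U\<close> that they do not reach splits off.  Hence the
  maximal dimension is the generic rank of \<open>[A, B]\<close> minus a penalty depending on \<open>U\<close> only.  The
  rank is submodular because one generic realization attains finitely many maximal ranks at once;
  the penalty is nonnegative and additive over unions of connected components.

  Genericity is tested along the line joining two realizations: a lower bound on the rank of a
  family of vectors that depends polynomially on a parameter fails for finitely many parameter
  values only, once it holds for one.
\<close>

section \<open>Generic rank along polynomial families of vectors\<close>

text \<open>Stabilizability depends on the signs of eigenvalues, so it is not an algebraic condition
  and cannot be tested generically. On the reached part it is replaced by the stronger demand that
  every nonzero mode be controlled. For symmetric \<open>X\<close> this is a lower bound on a rank:
  the vectors \<open>X^k F_j\<close> with \<open>k \<ge> 1\<close> must span the range of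
  \<open>X\<close>. Such a bound passes from one realization to a generic one only if the rank of
  \<open>X\<close> cannot grow, which is why controlled realizations are built with maximal rank.

  The induction uses a single input column. Deleting a vertex leaves one condition on an eigenvector
  that vanishes there, orthogonality to the deleted column, and this column may be nonzero exactly
  at the neighbours of the vertex.

  On the unreached part signs do matter: a nonzero symmetric realization with zero diagonal has
  eigenvalues of both signs. The maximal dimension there is never computed; only its additivity over
  separated blocks enters.\<close>

lemma finite_zeros_real_polynomial_function:
  fixes f :: "real \<Rightarrow> real"
  assumes "real_polynomial_function f" "f t0 \<noteq> 0"
  shows "finite {t. f t = 0}"
proof -
  obtain a n where f: "f = (\<lambda>x. \<Sum>i\<le>n. a i * x ^ i)"
    using assms(1) real_polynomial_function_iff_sum by blast
  have "\<exists>i\<le>n. a i \<noteq> 0"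
    using assms(2) unfolding f by (metis (no_types, lifting) atMost_iff mult_eq_0_iff sum.neutral)
  then show ?thesis
    using polyfun_finite_roots[of a n] by (simp add: f)
qed

lemma real_polynomial_function_line: "real_polynomial_function (\<lambda>t. a + t * b)"
  by (intro real_polynomial_function.intros(2-4) real_polynomial_function.intros(1)[OF bounded_linear_ident])

lemma real_polynomial_function_det:
  fixes M :: "real \<Rightarrow> real ^ 'n ^ 'n"
  assumes "\<And>i j. real_polynomial_function (\<lambda>t. M t $ i $ j)"
  shows "real_polynomial_function (\<lambda>t. det (M t))"
  unfolding det_def
  by (intro real_polynomial_function_sum real_polynomial_function.intros(2,4)
      real_polynomial_function_prod assms finite_permutations) auto

lemma det_nonzero_iff_dim_rows:
  fixes e :: "'n::finite \<Rightarrow> real ^ 'n"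
  shows "det (\<chi> k. e k) \<noteq> 0 \<longleftrightarrow> dim (range e) = CARD('n)"
proof -
  have "rows (\<chi> k. e k) = range e"
    by (auto simp: rows_def row_def vec_lambda_eta)
  then have "rank (\<chi> k. e k) = dim (range e)"
    by (simp add: row_rank_def)
  then show ?thesis
    using det_eq_0_rank[of "\<chi> k. e k"] rank_bound[of "\<chi> k. e k"] by auto
qed

lemma dim_Un_le_card:
  fixes S D :: "'a::euclidean_space set"
  assumes "finite D"
  shows "dim (S \<union> D) \<le> dim S + card D"
proof -
  obtain b where b: "b \<subseteq> S" "independent b" "S \<subseteq> span b" "card b = dim S"
    using basis_exists by blast
  have "S \<union> D \<subseteq> span (b \<union> D)"
    using b(3) span_mono[of b "b \<union> D"] span_superset[of "b \<union> D"] by auto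
  then have "dim (S \<union> D) \<le> card (b \<union> D)"
    using assms independent_bound[OF b(2)] by (intro dim_le_card) auto
  also have "\<dots> \<le> dim S + card D"
    using card_Un_le[of b D] b(4) by simp
  finally show ?thesis .
qed

text \<open>A basis picked from the family at \<open>t0\<close> is completed by fixed vectors to a
  basis of the whole space. With the picked vectors moving with \<open>t\<close>, the determinant of
  this frame is a polynomial that is nonzero at \<open>t0\<close>. Wherever it is nonzero, the
  family must supply all dimensions that the fixed vectors do not.\<close>

lemma finite_rank_drop:
  fixes f :: "real \<Rightarrow> 'i \<Rightarrow> real ^ 'n::finite"
  assumes poly: "\<And>i k. i \<in> I \<Longrightarrow> real_polynomial_function (\<lambda>t. f t i $ k)"
    and r: "r \<le> dim (f t0 ` I)"
  shows "finite {t. dim (f t ` I) < r}"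
proof -
  obtain b where b: "b \<subseteq> f t0 ` I" "independent b" "f t0 ` I \<subseteq> span b" "card b = dim (f t0 ` I)"
    using basis_exists by blast
  obtain b' where b': "b \<subseteq> b'" "independent b'" "UNIV \<subseteq> span b'"
    by (rule maximal_independent_subset_extend[OF subset_UNIV b(2)])
  have fin: "finite b'" and cb': "card b' = CARD('n)"
    using independent_bound[OF b'(2)] basis_card_eq_dim[OF subset_UNIV b'(3,2)] by auto
  obtain g :: "'n \<Rightarrow> _" where g: "bij_betw g UNIV b'"
    using finite_same_card_bij[of "UNIV :: 'n set" b'] fin cb' by auto
  \<comment> \<open>One index is fixed for each picked vector, so that the same members of the
    family can be followed as \<open>t\<close> varies.\<close>
  define pre where "pre v = (SOME i. i \<in> I \<and> f t0 i = v)" for v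
  have pre: "pre v \<in> I \<and> f t0 (pre v) = v" if "v \<in> b" for v
    unfolding pre_def by (rule someI_ex) (use that b(1) in auto)
  define e where "e t k = (if g k \<in> b then f t (pre (g k)) else g k)" for t k
  have "e t0 = g"
    by (auto simp: e_def pre)
  then have "range (e t0) = b'"
    using g by (simp add: bij_betw_imp_surj_on)
  then have "dim (range (e t0)) = CARD('n)"
    using b'(2) cb' by (simp add: dim_eq_card_independent)
  then have "det (\<chi> k. e t0 k) \<noteq> 0"
    using det_nonzero_iff_dim_rows by blast
  moreover have "real_polynomial_function (\<lambda>t. det (\<chi> k. e t k))"
  proof (rule real_polynomial_function_det)
    fix i j
    show "real_polynomial_function (\<lambda>t. (\<chi> k. e t k) $ i $ j)"
      by (cases "g i \<in> b") (auto simp: e_def pre poly)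
  qed
  ultimately have "finite {t. det (\<chi> k. e t k) = 0}"
    using finite_zeros_real_polynomial_function by blast
  moreover have "r \<le> dim (f t ` I)" if "det (\<chi> k. e t k) \<noteq> 0" for t
  proof -
    have "CARD('n) = dim (range (e t))"
      using that det_nonzero_iff_dim_rows by metis
    also have "\<dots> \<le> dim (f t ` I \<union> (b' - b))"
      using g by (intro dim_subset) (auto simp: e_def pre bij_betw_def)
    also have "\<dots> \<le> dim (f t ` I) + card (b' - b)"
      using fin by (intro dim_Un_le_card) auto
    also have "card (b' - b) = CARD('n) - dim (f t0 ` I)"
      using b'(1) b(4) cb' fin by (metis card_Diff_subset finite_subset)
    finally show ?thesis
      using r dim_subset_UNIV_cart[of "f t0 ` I"] by linarith
  qed
  then have "{t. dim (f t ` I) < r} \<subseteq> {t. det (\<chi> k. e t k) = 0}"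
    by (auto simp: not_le[symmetric])
  ultimately show ?thesis
    by (rule finite_subset[rotated])
qed

text \<open>The two bounds may be witnessed at different parameters. In the applications these are
  the two ends \<open>0\<close> and \<open>1\<close> of a line of realizations, each good for one of
  the bounds.\<close>

lemma common_generic_point:
  fixes f :: "real \<Rightarrow> 'i \<Rightarrow> real ^ 'n" and g :: "real \<Rightarrow> 'j \<Rightarrow> real ^ 'm"
  assumes "\<And>i k. i \<in> I \<Longrightarrow> real_polynomial_function (\<lambda>t. f t i $ k)"
    and "\<And>j k. j \<in> J \<Longrightarrow> real_polynomial_function (\<lambda>t. g t j $ k)"
    and "r \<le> dim (f t0 ` I)" "s \<le> dim (g t1 ` J)"
  shows "\<exists>t. r \<le> dim (f t ` I) \<and> s \<le> dim (g t ` J)"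
proof -
  have "finite ({t. dim (f t ` I) < r} \<union> {t. dim (g t ` J) < s})"
    using finite_rank_drop[of I f r t0] finite_rank_drop[of J g s t1] assms by auto
  then show ?thesis
    using ex_new_if_finite[OF infinite_UNIV_char_0] by (metis (mono_tags, lifting) UnCI mem_Collect_eq not_le)
qed

lemma real_polynomial_function_matrix_vector_mult:
  fixes A :: "real \<Rightarrow> real ^ 'n ^ 'm" and x :: "real \<Rightarrow> real ^ 'n"
  assumes "\<And>i j. real_polynomial_function (\<lambda>t. A t $ i $ j)"
    and "\<And>j. real_polynomial_function (\<lambda>t. x t $ j)"
  shows "real_polynomial_function (\<lambda>t. (A t *v x t) $ i)"
  unfolding matrix_vector_mult_def
  by (simp, intro real_polynomial_function_sum real_polynomial_function.intros(4) assms) auto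

section \<open>Symmetric real matrices\<close>

lemma symmetric_matrix_inner:
  fixes A :: "real ^ 'n ^ 'n"
  assumes "transpose A = A"
  shows "(A *v x) \<bullet> y = x \<bullet> (A *v y)"
  using dot_lmul_matrix[of x A y] assms by (metis transpose_matrix_vector)

text \<open>A maximizer \<open>v\<close> of \<open>norm (A *v v)\<close> on the unit sphere of \<open>U\<close> satisfies
  \<open>A *v (A *v v) = \<mu>\<^sup>2 *\<^sub>R v\<close> by the equality case of Cauchy-Schwarz, and this factors
  into eigenvectors for \<open>\<mu>\<close> and \<open>-\<mu>\<close>.\<close>

lemma symmetric_nonzero_eigenvector:
  fixes A :: "real ^ 'n ^ 'n"
  assumes sym: "transpose A = A" and U: "subspace U" and inv: "\<And>x. x \<in> U \<Longrightarrow> A *v x \<in> U"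
    and nz: "x0 \<in> U" "A *v x0 \<noteq> 0"
  obtains v l where "v \<in> U" "v \<noteq> 0" "l \<noteq> 0" "A *v v = l *\<^sub>R v"
proof -
  define K where "K = sphere 0 1 \<inter> U"
  have "compact K"
    unfolding K_def by (intro compact_Int_closed closed_subspace U compact_sphere)
  moreover have x0: "x0 \<noteq> 0"
    using nz(2) by auto
  then have "x0 /\<^sub>R norm x0 \<in> K"
    using nz(1) U by (simp add: K_def subspace_scale)
  moreover have "continuous_on K (\<lambda>x. norm (A *v x))"
    by (intro continuous_intros)
  ultimately obtain v where v: "v \<in> K" "\<And>y. y \<in> K \<Longrightarrow> norm (A *v y) \<le> norm (A *v v)"
    using continuous_attains_sup[of K "\<lambda>x. norm (A *v x)"] by blast
  define m where "m = norm (A *v v)"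
  have nv: "norm v = 1" "v \<in> U"
    using v(1) by (auto simp: K_def)
  have bound: "norm (A *v y) \<le> m * norm y" if "y \<in> U" for y
  proof (cases "y = 0")
    case False
    then have "norm (A *v (y /\<^sub>R norm y)) \<le> m"
      using that U v(2) by (auto simp: K_def m_def subspace_scale)
    then show ?thesis
      using False by (simp add: matrix_vector_mult_scaleR field_simps)
  qed simp
  have "m > 0"
    using bound[OF nz(1)] nz(2) x0 by (metis linorder_not_le mult_nonpos_nonneg norm_ge_zero norm_le_zero_iff order_trans)
  define w where "w = A *v (A *v v)"
  have "w \<bullet> v = m\<^sup>2"
    by (simp add: w_def m_def symmetric_matrix_inner[OF sym] power2_norm_eq_inner)
  moreover have "norm w \<le> m * m"
    using bound[of "A *v v"] inv[OF nv(2)] by (simp add: w_def m_def)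
  then have "w \<bullet> w \<le> (m * m)\<^sup>2"
    by (metis norm_ge_zero power2_norm_eq_inner power_mono)
  ultimately have "(w - m\<^sup>2 *\<^sub>R v) \<bullet> (w - m\<^sup>2 *\<^sub>R v) \<le> 0"
    using nv(1) by (simp add: inner_diff_left inner_diff_right inner_commute norm_eq_1 power2_eq_square)
  then have w: "w = m\<^sup>2 *\<^sub>R v"
    by (metis inner_gt_zero_iff not_le right_minus_eq)
  show ?thesis
  proof (cases "A *v v = m *\<^sub>R v")
    case True
    then show ?thesis
      using that[of v m] nv \<open>m > 0\<close> by (metis less_irrefl norm_zero zero_neq_one)
  next
    case False
    define z where "z = A *v v - m *\<^sub>R v"
    have "A *v z = (- m) *\<^sub>R z"
      using w by (simp add: z_def w_def matrix_vector_mult_diff_distrib matrix_vector_mult_scaleR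
          scaleR_diff_right power2_eq_square)
    moreover have "z \<in> U"
      unfolding z_def by (intro subspace_diff subspace_scale U inv nv)
    ultimately show ?thesis
      using that[of z "- m"] False \<open>m > 0\<close> by (auto simp: z_def)
  qed
qed

text \<open>Eigenvectors for distinct eigenvalues are orthogonal, so choosing one for each
  eigenvalue gives an independent set.\<close>

lemma finite_symmetric_eigenvalues:
  fixes A :: "real ^ 'n ^ 'n"
  assumes "transpose A = A"
  shows "finite {l. \<exists>v. v \<noteq> 0 \<and> A *v v = l *\<^sub>R v}"
proof -
  let ?L = "{l. \<exists>v. v \<noteq> 0 \<and> A *v v = l *\<^sub>R v}"
  define e where "e l = (SOME v. v \<noteq> 0 \<and> A *v v = l *\<^sub>R v)" for l :: real
  have e: "e l \<noteq> 0" "A *v e l = l *\<^sub>R e l" if "l \<in> ?L" for l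
    using that someI_ex[of "\<lambda>v. v \<noteq> 0 \<and> A *v v = l *\<^sub>R v"] by (auto simp: e_def)
  have orth: "e l \<bullet> e m = 0" if "l \<in> ?L" "m \<in> ?L" "l \<noteq> m" for l m
    using symmetric_matrix_inner[OF assms, of "e l" "e m"] e that by auto
  have "inj_on e ?L"
  proof (rule inj_onI, rule ccontr)
    fix l m assume "l \<in> ?L" "m \<in> ?L" "e l = e m" "l \<noteq> m"
    then show False
      using orth[of l m] e(1)[of m] by simp
  qed
  moreover have "independent (e ` ?L)"
  proof (rule pairwise_orthogonal_independent)
    show "pairwise orthogonal (e ` ?L)"
      using orth by (fastforce simp add: pairwise_def orthogonal_def)
    show "0 \<notin> e ` ?L"
      using e(1) by fastforce
  qed
  then have "finite (e ` ?L)"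
    using independent_bound by blast
  ultimately show ?thesis
    using finite_imageD by blast
qed

section \<open>The stabilizable subspace of a symmetric pair\<close>

definition col_space :: "real ^ 'n ^ 'n \<Rightarrow> 'c set \<Rightarrow> ('c \<Rightarrow> real ^ 'n) \<Rightarrow> (real ^ 'n) set" where
  "col_space A C F = span (range ((*v) A) \<union> F ` C)"

text \<open>The Popov-Belevitch-Hautus eigenvector test, restricted to nonzero eigenvalues; real
  ones suffice for symmetric \<open>A\<close>. The eigenvalue 0 is exempt because kernel vectors
  orthogonal to all columns are exactly what \<open>col_space\<close> misses.\<close>

definition controls_nonzero_modes ::
    "real ^ 'n ^ 'n \<Rightarrow> 'c set \<Rightarrow> ('c \<Rightarrow> real ^ 'n) \<Rightarrow> bool" where
  "controls_nonzero_modes A C F \<longleftrightarrow>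
     (\<forall>v l. l \<noteq> 0 \<longrightarrow> A *v v = l *\<^sub>R v \<longrightarrow> (\<forall>j\<in>C. F j \<bullet> v = 0) \<longrightarrow> v = 0)"

lemma in_span_if_orthogonal_complement:
  fixes x :: "'a::euclidean_space"
  assumes "\<And>v. (\<And>q. q \<in> S \<Longrightarrow> v \<bullet> q = 0) \<Longrightarrow> v \<bullet> x = 0"
  shows "x \<in> span S"
proof -
  obtain y z where yz: "y \<in> span S" "\<And>w. w \<in> span S \<Longrightarrow> orthogonal z w" "x = y + z"
    using orthogonal_subspace_decomp_exists by metis
  have "z \<bullet> x = 0"
    by (rule assms) (use yz(2) span_base in \<open>auto simp: orthogonal_def\<close>)
  moreover have "z \<bullet> y = 0"
    using yz(1,2) by (auto simp: orthogonal_def)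
  ultimately have "z \<bullet> z = 0"
    by (simp add: yz(3) inner_add_right)
  then show ?thesis
    using yz by simp
qed

text \<open>A vector orthogonal to the range of \<open>A\<close> and to all columns defines a
  quantity conserved along every trajectory; convergence to 0 forces its initial value to be
  0.\<close>

lemma stabilizable_subspace_subset_col_space:
  assumes "transpose A = A"
  shows "stabilizable_subspace A C F \<subseteq> col_space A C F"
proof
  fix x0 assume "x0 \<in> stabilizable_subspace A C F"
  then obtain u x where tr: "trajectory A C F u x" and x: "x 0 = x0" "(x \<longlongrightarrow> 0) at_top"
    unfolding stabilizable_subspace_def by blast
  show "x0 \<in> col_space A C F"
    unfolding col_space_def
  proof (rule in_span_if_orthogonal_complement)
    fix v assume v: "\<And>q. q \<in> range ((*v) A) \<union> F ` C \<Longrightarrow> v \<bullet> q = 0"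
    have "((\<lambda>t. v \<bullet> x t) has_vector_derivative 0) (at t within {0..})" if "t \<ge> 0" for t
    proof -
      have "((\<lambda>t. v \<bullet> x t) has_vector_derivative v \<bullet> (A *v x t + (\<Sum>j\<in>C. u t j *\<^sub>R F j)))
          (at t within {0..})"
        using tr that unfolding trajectory_def
        by (intro bounded_linear.has_vector_derivative[OF bounded_linear_inner_right]) auto
      moreover have "v \<bullet> (A *v x t + (\<Sum>j\<in>C. u t j *\<^sub>R F j)) = 0"
        using v by (simp add: inner_add_right inner_sum_right)
      ultimately show ?thesis
        by simp
    qed
    then have "\<exists>c. \<forall>t\<in>{0..}. v \<bullet> x t = c"
      by (metis atLeast_iff convex_real_interval(1) has_vector_derivative_zero_constant)
    then have "eventually (\<lambda>t. v \<bullet> x t = v \<bullet> x0) at_top"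
      unfolding x(1)[symmetric] eventually_at_top_linorder by (metis atLeast_iff order_refl)
    then have "((\<lambda>t. v \<bullet> x t) \<longlongrightarrow> v \<bullet> x0) at_top"
      by (rule tendsto_eventually)
    moreover have "((\<lambda>t. v \<bullet> x t) \<longlongrightarrow> v \<bullet> 0) at_top"
      by (intro tendsto_intros x)
    ultimately show "v \<bullet> x0 = 0"
      using tendsto_unique trivial_limit_at_top_linorder by (metis inner_zero_right)
  qed
qed

lemma in_stabilizable_subspace_if_decaying_mode:
  assumes "s > 0" and eq: "A *v z + (\<Sum>j\<in>C. u j *\<^sub>R F j) = - (s *\<^sub>R z)"
  shows "z \<in> stabilizable_subspace A C F"
proof -
  define x where "x t = exp (- (s * t)) *\<^sub>R z" for t
  have "trajectory A C F (\<lambda>t j. exp (- (s * t)) * u j) x"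
    unfolding trajectory_def
  proof (intro allI impI)
    fix t :: real
    have "A *v x t + (\<Sum>j\<in>C. (exp (- (s * t)) * u j) *\<^sub>R F j)
        = exp (- (s * t)) *\<^sub>R (A *v z + (\<Sum>j\<in>C. u j *\<^sub>R F j))"
      by (simp add: x_def matrix_vector_mult_scaleR scaleR_add_right scaleR_sum_right)
    also have "\<dots> = (- s * exp (- (s * t))) *\<^sub>R z"
      by (simp add: eq)
    finally show "(x has_vector_derivative A *v x t + (\<Sum>j\<in>C. (exp (- (s * t)) * u j) *\<^sub>R F j))
        (at t within {0..})"
      unfolding x_def
      by (auto intro!: derivative_eq_intros has_vector_derivative_scaleR
          simp: has_real_derivative_iff_has_vector_derivative[symmetric])
  qed
  moreover have "((\<lambda>t. exp (- (s * t))) \<longlongrightarrow> 0) at_top"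
    using \<open>s > 0\<close>
    by (intro filterlim_compose[OF exp_at_bot] filterlim_compose[OF filterlim_uminus_at_bot_at_top]
        filterlim_tendsto_pos_mult_at_top[OF tendsto_const] filterlim_ident)
  then have "(x \<longlongrightarrow> 0) at_top"
    unfolding x_def using tendsto_scaleR[OF _ tendsto_const[of z]] by force
  moreover have "x 0 = z"
    by (simp add: x_def)
  ultimately show ?thesis
    unfolding stabilizable_subspace_def by blast
qed

text \<open>For large \<open>s\<close> the states \<open>(A + s I)\<^sup>-\<^sup>1 F\<^sub>j\<close> decay exponentially under a
  suitable input; they span an \<open>A\<close>-invariant space that contains every \<open>F\<^sub>j\<close>.\<close>

lemma col_space_subset_stabilizable_subspace:
  fixes F :: "'c \<Rightarrow> real ^ 'n"
  assumes sym: "transpose A = A" and "finite C" and ctrl: "controls_nonzero_modes A C F"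
  shows "col_space A C F \<subseteq> stabilizable_subspace A C F"
proof -
  obtain K where K: "K > 0" "\<And>x. norm (A *v x) \<le> norm x * K"
    using bounded_linear.pos_bounded[OF matrix_vector_mul_bounded_linear[of A]] by blast
  have res: "\<exists>z. A *v z + s *\<^sub>R z = b" if "s > K" for s b
  proof -
    have lin: "linear (\<lambda>z. A *v z + s *\<^sub>R z)"
      by (intro linear_compose_add matrix_vector_mul_linear linear_compose_scale_right linear_ident)
    have "inj (\<lambda>z. A *v z + s *\<^sub>R z)"
      unfolding linear_injective_0[OF lin]
    proof (intro allI impI)
      fix z assume "A *v z + s *\<^sub>R z = 0"
      then have "A *v z = - (s *\<^sub>R z)"
        by (simp add: eq_neg_iff_add_eq_0)
      then have "norm (s *\<^sub>R z) \<le> norm z * K"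
        using K(2)[of z] by simp
      then have "(s - K) * norm z \<le> 0"
        using that K(1) by (simp add: algebra_simps)
      then show "z = 0"
        using that by (simp add: mult_le_0_iff)
    qed
    then have "surj (\<lambda>z. A *v z + s *\<^sub>R z)"
      using linear_injective_imp_surjective lin by blast
    then obtain z where "b = A *v z + s *\<^sub>R z"
      by (rule surjE)
    then show ?thesis
      by auto
  qed
  define Q where "Q = span {z. \<exists>s j. s > K \<and> j \<in> C \<and> A *v z + s *\<^sub>R z = F j}"
  have "{z. \<exists>s j. s > K \<and> j \<in> C \<and> A *v z + s *\<^sub>R z = F j} \<subseteq> stabilizable_subspace A C F"
  proof
    fix z assume "z \<in> {z. \<exists>s j. s > K \<and> j \<in> C \<and> A *v z + s *\<^sub>R z = F j}"
    then obtain s j where *: "s > K" "j \<in> C" "A *v z + s *\<^sub>R z = F j"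
      by blast
    have "(\<Sum>i\<in>C. (if i = j then - 1 else 0) *\<^sub>R F i) = (\<Sum>i\<in>C. if i = j then - F i else 0)"
      by (rule sum.cong) auto
    also have "\<dots> = - F j"
      using *(2) \<open>finite C\<close> by simp
    finally have eq: "A *v z + (\<Sum>i\<in>C. (if i = j then - 1 else 0) *\<^sub>R F i) = - (s *\<^sub>R z)"
      using *(3)[symmetric] by simp
    then show "z \<in> stabilizable_subspace A C F"
      by (rule in_stabilizable_subspace_if_decaying_mode[rotated]) (use *(1) K(1) in simp)
  qed
  then have Q_stab: "Q \<subseteq> stabilizable_subspace A C F"
    unfolding Q_def by (intro span_minimal subspace_stabilizable_subspace)
  \<comment> \<open>As \<open>s\<close> grows, \<open>A\<close> becomes negligible against
    \<open>s\<close>, so \<open>s *\<^sub>R z s\<close> tends to \<open>F j\<close>; the subspace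
    \<open>Q\<close> is closed.\<close>
  have FQ: "F j \<in> Q" if "j \<in> C" for j
  proof -
    define z where "z s = (SOME z. A *v z + s *\<^sub>R z = F j)" for s
    have z: "A *v z s + s *\<^sub>R z s = F j" if "s > K" for s
      unfolding z_def by (rule someI_ex[OF res[OF that]])
    have "norm (s *\<^sub>R z s - F j) \<le> K * (norm (F j) / (s - K))" if "s > K" for s
    proof -
      have "s *\<^sub>R z s = F j - A *v z s"
        using z[OF that] by (simp add: algebra_simps)
      then have "norm (s *\<^sub>R z s) \<le> norm (F j) + norm (z s) * K"
        using norm_triangle_ineq4[of "F j" "A *v z s"] K(2)[of "z s"] by simp
      then have "(s - K) * norm (z s) \<le> norm (F j)"
        using that K(1) by (simp add: algebra_simps)
      then have "norm (z s) \<le> norm (F j) / (s - K)"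
        using that by (simp add: field_simps)
      moreover have "norm (s *\<^sub>R z s - F j) \<le> K * norm (z s)"
        using K(2)[of "z s"] \<open>s *\<^sub>R z s = _\<close> by (simp add: mult.commute)
      ultimately show ?thesis
        using K(1) by (elim order_trans mult_left_mono) simp
    qed
    then have "eventually (\<lambda>s. norm (s *\<^sub>R z s - F j) \<le> K * (norm (F j) / (s - K))) at_top"
      using eventually_gt_at_top[of K] by (rule eventually_mono[rotated])
    moreover have "((\<lambda>s. K * (norm (F j) / (s - K))) \<longlongrightarrow> 0) at_top"
      by (intro tendsto_mult_right_zero tendsto_divide_0[OF tendsto_const]
          filterlim_at_top_imp_at_infinity filterlim_tendsto_add_at_top[OF tendsto_const[of "- K"], simplified] filterlim_ident)
    ultimately have "((\<lambda>s. s *\<^sub>R z s - F j) \<longlongrightarrow> 0) at_top"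
      by (rule Lim_null_comparison)
    then have lim: "((\<lambda>s. s *\<^sub>R z s) \<longlongrightarrow> F j) at_top"
      by (simp add: LIM_zero_iff)
    have "eventually (\<lambda>s. s *\<^sub>R z s \<in> Q) at_top"
      using eventually_gt_at_top[of K]
    proof (rule eventually_mono)
      fix s assume "s > K"
      then show "s *\<^sub>R z s \<in> Q"
        unfolding Q_def using z[of s] that by (intro span_scale span_base) blast
    qed
    then show ?thesis
      using Lim_in_closed_set[OF closed_subspace _ _ lim, of Q] by (auto simp: Q_def)
  qed
  have AQ: "A *v q \<in> Q" if "q \<in> Q" for q
    using that unfolding Q_def
  proof (induction rule: span_induct)
    case base
    then show ?case
      by (auto simp: subspace_def span_zero span_add span_scale matrix_vector_right_distrib matrix_vector_mult_scaleR)
  next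
    case (step z)
    then obtain s j where *: "s > K" "j \<in> C" "A *v z + s *\<^sub>R z = F j"
      by blast
    then have "A *v z = F j - s *\<^sub>R z"
      by (simp add: algebra_simps)
    moreover have "z \<in> Q"
      using * unfolding Q_def by (intro span_base) blast
    ultimately show ?case
      using FQ[OF *(2)] unfolding Q_def by (auto intro: span_diff span_scale)
  qed
  \<comment> \<open>By symmetry the orthogonal complement of \<open>Q\<close> is invariant too. A
    nonzero mode in it would escape every column, so \<open>A\<close> vanishes there, and hence the
    range of \<open>A\<close> lies in \<open>Q\<close>.\<close>
  define U where "U = {v. \<forall>q\<in>Q. v \<bullet> q = 0}"
  have U: "subspace U"
    by (auto simp: U_def subspace_def inner_add_left)
  have AU: "A *v v \<in> U" if "v \<in> U" for v
    using that AQ by (auto simp: U_def symmetric_matrix_inner[OF sym])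
  have kerU: "A *v v = 0" if v: "v \<in> U" for v
  proof (rule ccontr)
    assume "A *v v \<noteq> 0"
    then obtain w l where w: "w \<in> U" "w \<noteq> 0" "l \<noteq> 0" "A *v w = l *\<^sub>R w"
      using symmetric_nonzero_eigenvector[OF sym U AU v] by blast
    moreover have "\<forall>j\<in>C. F j \<bullet> w = 0"
      using w(1) FQ by (auto simp: U_def inner_commute)
    ultimately show False
      using ctrl unfolding controls_nonzero_modes_def by blast
  qed
  have "A *v y \<in> Q" for y
  proof -
    have "A *v y \<in> span Q"
      by (rule in_span_if_orthogonal_complement)
        (use kerU in \<open>auto simp: U_def symmetric_matrix_inner[OF sym, symmetric]\<close>)
    then show ?thesis
      by (simp add: Q_def span_span)
  qed
  then have "col_space A C F \<subseteq> Q"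
    unfolding col_space_def using FQ by (intro span_minimal) (auto simp: Q_def)
  then show ?thesis
    using Q_stab by blast
qed

text \<open>An intertwining map carries trajectories to trajectories under the same input. The maps
  in question are coordinate projections.\<close>

lemma stabilizable_subspace_map:
  fixes P :: "real ^ 'n \<Rightarrow> real ^ 'n"
  assumes P: "linear P" and "\<And>x. P (A *v x) = A' *v P x" and "\<And>j. j \<in> C \<Longrightarrow> P (F j) = F' j"
    and a: "a \<in> stabilizable_subspace A C F"
  shows "P a \<in> stabilizable_subspace A' C F'"
proof -
  obtain u x where tr: "trajectory A C F u x" and x: "x 0 = a" "(x \<longlongrightarrow> 0) at_top"
    using a unfolding stabilizable_subspace_def by blast
  have bl: "bounded_linear P"
    using P linear_conv_bounded_linear by blast
  have "trajectory A' C F' u (\<lambda>t. P (x t))"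
    unfolding trajectory_def
  proof (intro allI impI)
    fix t :: real assume t: "t \<ge> 0"
    have "P (A *v x t + (\<Sum>j\<in>C. u t j *\<^sub>R F j)) = A' *v P (x t) + (\<Sum>j\<in>C. u t j *\<^sub>R F' j)"
      using assms(2,3) by (simp add: linear_add[OF P] linear_sum[OF P] linear_scale[OF P])
    then show "((\<lambda>t. P (x t)) has_vector_derivative A' *v P (x t) + (\<Sum>j\<in>C. u t j *\<^sub>R F' j))
        (at t within {0..})"
      using tr t bounded_linear.has_vector_derivative[OF bl] unfolding trajectory_def by metis
  qed
  moreover have "((\<lambda>t. P (x t)) \<longlongrightarrow> 0) at_top"
    using bounded_linear.tendsto[OF bl x(2)] linear_0[OF P] by simp
  ultimately show ?thesis
    unfolding stabilizable_subspace_def using x(1) by auto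
qed

section \<open>Krylov spaces\<close>

text \<open>Powers start at one, unlike in the usual Krylov space. All vectors then lie in the range
  of \<open>X\<close>, so that \<open>rank X\<close> is the largest dimension they can span.\<close>

definition krylov :: "real ^ 'n ^ 'n \<Rightarrow> ('c \<Rightarrow> real ^ 'n) \<Rightarrow> nat \<times> 'c \<Rightarrow> real ^ 'n" where
  "krylov X F = (\<lambda>(k, j). ((*v) X ^^ Suc k) (F j))"

lemma real_polynomial_function_krylov:
  fixes X :: "real \<Rightarrow> real ^ 'n ^ 'n" and F :: "real \<Rightarrow> 'c \<Rightarrow> real ^ 'n"
  assumes "\<And>i j. real_polynomial_function (\<lambda>t. X t $ i $ j)"
    and "\<And>i. real_polynomial_function (\<lambda>t. F t (snd q) $ i)"
  shows "real_polynomial_function (\<lambda>t. krylov (X t) (F t) q $ i)"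
proof -
  obtain k j where q: "q = (k, j)"
    by (cases q)
  have "real_polynomial_function (\<lambda>t. ((*v) (X t) ^^ n) (F t j) $ i)" for n i
  proof (induction n arbitrary: i)
    case 0
    then show ?case
      using assms(2) by (simp add: q)
  next
    case (Suc n)
    then show ?case
      using real_polynomial_function_matrix_vector_mult[OF assms(1)] by simp
  qed
  from this[of "Suc k" i] show ?thesis
    by (simp add: krylov_def q del: funpow.simps)
qed

text \<open>An eigenvector orthogonal to all columns is orthogonal to the whole Krylov space, by
  symmetry. The rank bound makes that space the range of \<open>X\<close>, which contains every
  eigenvector for a nonzero eigenvalue.\<close>

lemma controls_nonzero_modes_if_krylov:
  fixes X :: "real ^ 'n ^ 'n"
  assumes sym: "transpose X = X" and rank: "rank X \<le> dim (krylov X F ` (UNIV \<times> C))"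
  shows "controls_nonzero_modes X C F"
  unfolding controls_nonzero_modes_def
proof (intro allI impI)
  fix v l assume v: "l \<noteq> 0" "X *v v = l *\<^sub>R v" "\<forall>j\<in>C. F j \<bullet> v = 0"
  let ?K = "krylov X F ` (UNIV \<times> C)"
  have "((*v) X ^^ k) (F j) \<bullet> v = 0" if "j \<in> C" for k j
    by (induction k) (use v that in \<open>auto simp: symmetric_matrix_inner[OF sym]\<close>)
  then have "q \<bullet> v = 0" if "q \<in> ?K" for q
    using that by (auto simp: krylov_def simp del: funpow.simps)
  then have perp: "v \<bullet> q = 0" if "q \<in> span ?K" for q
    using that orthogonal_to_span[of q ?K v] by (simp add: orthogonal_def inner_commute)
  have "?K \<subseteq> range ((*v) X)"
    by (auto simp: krylov_def)
  then have "span ?K = span (range ((*v) X))"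
    using rank by (intro dim_eq_span) (auto simp: rank_dim_range)
  moreover have "v = X *v ((1 / l) *\<^sub>R v)"
    using v(1,2) by (simp add: matrix_vector_mult_scaleR)
  ultimately have "v \<in> span ?K"
    by (metis rangeI span_base)
  then show "v = 0"
    using perp inner_eq_zero_iff by blast
qed

text \<open>The orthogonal complement of the Krylov vectors is invariant. An eigenvector in it with
  nonzero eigenvalue would be orthogonal to every \<open>F j\<close>, so \<open>X\<close> vanishes
  on this complement and its range lies in the Krylov space.\<close>

lemma rank_le_krylov_if_controls_nonzero_modes:
  fixes X :: "real ^ 'n ^ 'n"
  assumes sym: "transpose X = X" and ctrl: "controls_nonzero_modes X C F"
  shows "rank X \<le> dim (krylov X F ` (UNIV \<times> C))"
proof -
  let ?K = "krylov X F ` (UNIV \<times> C)"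
  define U where "U = {u. \<forall>q\<in>?K. u \<bullet> q = 0}"
  have U: "subspace U"
    by (auto simp: U_def subspace_def inner_add_left)
  have XK: "X *v q \<in> ?K" if q: "q \<in> ?K" for q
  proof -
    obtain k j where "j \<in> C" "q = krylov X F (k, j)"
      using q by auto
    then have "X *v q = krylov X F (Suc k, j)"
      by (simp add: krylov_def)
    then show ?thesis
      using \<open>j \<in> C\<close> by auto
  qed
  have XU: "X *v u \<in> U" if "u \<in> U" for u
    unfolding U_def
  proof (intro CollectI ballI)
    fix q assume "q \<in> ?K"
    then have "u \<bullet> (X *v q) = 0"
      using that XK[of q] unfolding U_def by blast
    then show "(X *v u) \<bullet> q = 0"
      by (simp add: symmetric_matrix_inner[OF sym])
  qed
  have ker: "X *v v = 0" if v: "v \<in> U" for v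
  proof (rule ccontr)
    assume "X *v v \<noteq> 0"
    then obtain w l where w: "w \<in> U" "w \<noteq> 0" "l \<noteq> 0" "X *v w = l *\<^sub>R w"
      using symmetric_nonzero_eigenvector[OF sym U XU v] by metis
    have "F j \<bullet> w = 0" if j: "j \<in> C" for j
    proof -
      have "krylov X F (0, j) \<in> ?K"
        using j by auto
      then have "w \<bullet> (X *v F j) = 0"
        using w(1) by (auto simp: U_def krylov_def)
      then have "l * (w \<bullet> F j) = 0"
        using w(4) by (simp add: symmetric_matrix_inner[OF sym, symmetric])
      then show ?thesis
        using w(3) by (simp add: inner_commute)
    qed
    then show False
      using ctrl w(2-4) unfolding controls_nonzero_modes_def by blast
  qed
  have "X *v y \<in> span ?K" for y
  proof (rule in_span_if_orthogonal_complement)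
    fix v assume "\<And>q. q \<in> ?K \<Longrightarrow> v \<bullet> q = 0"
    then have "v \<in> U"
      by (simp add: U_def)
    then show "v \<bullet> (X *v y) = 0"
      using ker by (simp add: symmetric_matrix_inner[OF sym, symmetric])
  qed
  then have "dim (range ((*v) X)) \<le> dim (span ?K)"
    by (intro dim_subset) auto
  then show ?thesis
    by (simp add: rank_dim_range)
qed

section \<open>Matrices supported on a block\<close>

text \<open>Blocks stay inside the full space, padded with zeros, instead of using smaller index
  types. Induction over subsets of vertices then takes place in one type.\<close>

definition coord_space :: "'n set \<Rightarrow> (real ^ 'n) set" where
  "coord_space S = {x. \<forall>i. i \<notin> S \<longrightarrow> x $ i = 0}"

definition coord_proj :: "'n set \<Rightarrow> real ^ 'n \<Rightarrow> real ^ 'n" where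
  "coord_proj S x = (\<chi> i. if i \<in> S then x $ i else 0)"

definition supported_on :: "'n set \<Rightarrow> real ^ 'n ^ 'n \<Rightarrow> bool" where
  "supported_on S X \<longleftrightarrow> (\<forall>i j. X $ i $ j \<noteq> 0 \<longrightarrow> i \<in> S \<and> j \<in> S)"

definition compress :: "'n set \<Rightarrow> real ^ 'n ^ 'n \<Rightarrow> real ^ 'n ^ 'n" where
  "compress S X = (\<chi> i j. if i \<in> S \<and> j \<in> S then X $ i $ j else 0)"

lemma linear_coord_proj: "linear (coord_proj S)"
  by (rule linearI) (auto simp: coord_proj_def vec_eq_iff)

lemma coord_proj_ident: "x \<in> coord_space S \<Longrightarrow> coord_proj S x = x"
  by (auto simp: coord_proj_def coord_space_def vec_eq_iff)

lemma coord_proj_in: "coord_proj S x \<in> coord_space S"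
  by (simp add: coord_proj_def coord_space_def)

lemma coord_proj_disjoint: "x \<in> coord_space S \<Longrightarrow> S \<inter> T = {} \<Longrightarrow> coord_proj T x = 0"
  by (auto simp: coord_proj_def coord_space_def vec_eq_iff)

lemma coord_proj_add_disjoint:
  "x \<in> coord_space (S \<union> T) \<Longrightarrow> S \<inter> T = {} \<Longrightarrow> coord_proj S x + coord_proj T x = x"
  by (auto simp: coord_proj_def coord_space_def vec_eq_iff)

lemma coord_space_inner_disjoint:
  assumes "x \<in> coord_space S" "y \<in> coord_space T" "S \<inter> T = {}"
  shows "x \<bullet> y = 0"
proof -
  have "x $ i * y $ i = 0" for i
    using assms by (cases "i \<in> S") (auto simp: coord_space_def)
  then show ?thesis
    unfolding inner_vec_def inner_real_def by (intro sum.neutral) blast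
qed

lemma subspace_coord_space: "subspace (coord_space S)"
  by (auto simp: coord_space_def subspace_def)

lemma coord_space_mono: "S \<subseteq> T \<Longrightarrow> coord_space S \<subseteq> coord_space T"
  by (auto simp: coord_space_def)

lemma supported_on_mult_in: "supported_on S X \<Longrightarrow> X *v x \<in> coord_space S"
  by (fastforce simp: supported_on_def coord_space_def matrix_vector_mult_def intro: sum.neutral)

lemma supported_on_mult_coord_proj:
  assumes "supported_on S X" "S \<subseteq> T"
  shows "X *v coord_proj T x = X *v x"
proof -
  have "X $ i $ j * coord_proj T x $ j = X $ i $ j * x $ j" for i j
    using assms by (cases "X $ i $ j = 0") (auto simp: supported_on_def coord_proj_def)
  then have "(\<Sum>j\<in>UNIV. X $ i $ j * coord_proj T x $ j) = (\<Sum>j\<in>UNIV. X $ i $ j * x $ j)" for i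
    by (intro sum.cong) auto
  then show ?thesis
    by (simp add: matrix_vector_mult_def)
qed

lemma supported_on_mult_coord_proj_disjoint:
  fixes X :: "real ^ 'n ^ 'n"
  assumes "supported_on S X" "S \<inter> T = {}"
  shows "X *v coord_proj T x = 0"
proof -
  have "X $ i $ j * coord_proj T x $ j = 0" for i j
    using assms by (cases "X $ i $ j = 0") (auto simp: supported_on_def coord_proj_def)
  then have "(\<Sum>j\<in>UNIV. X $ i $ j * coord_proj T x $ j) = 0" for i
    by (intro sum.neutral) auto
  then show ?thesis
    by (simp add: matrix_vector_mult_def vec_eq_iff)
qed

lemma dim_sum_disjoint_coord_spaces:
  assumes "subspace U" "subspace V" "U \<subseteq> coord_space S" "V \<subseteq> coord_space T" "S \<inter> T = {}"
  shows "dim {x + y |x y. x \<in> U \<and> y \<in> V} = dim U + dim V"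
proof -
  have "x = 0" if "x \<in> U \<inter> V" for x
    using that assms(3-5) coord_space_inner_disjoint[of x S x T] by auto
  then have "U \<inter> V = {0}"
    using assms(1,2) by (auto simp: subspace_0)
  then show ?thesis
    using dim_sums_Int[OF assms(1,2)] by simp
qed

lemma subspace_col_space: "subspace (col_space X C F)"
  by (simp add: col_space_def)

lemma dim_col_space_empty: "dim (col_space X {} F) = rank X"
  by (simp add: col_space_def rank_dim_range)

lemma col_space_subset_coord_space:
  assumes "supported_on S X" "\<And>j. j \<in> C \<Longrightarrow> F j \<in> coord_space S"
  shows "col_space X C F \<subseteq> coord_space S"
  unfolding col_space_def
  by (intro span_minimal subspace_coord_space) (use assms supported_on_mult_in in auto)

text \<open>A block \<open>X\<close> that receives all inputs next to an autonomous block
  \<open>Y\<close>; \<open>X + Y\<close> is their block-diagonal matrix.\<close>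

locale separated_blocks =
  fixes S T :: "'n::finite set" and X Y :: "real ^ 'n ^ 'n" and C :: "'c set" and F :: "'c \<Rightarrow> real ^ 'n"
  assumes disj: "S \<inter> T = {}" and X: "supported_on S X" and Y: "supported_on T Y"
    and F: "\<And>j. j \<in> C \<Longrightarrow> F j \<in> coord_space S"
begin

lemma coord_proj_mult:
  "coord_proj S ((X + Y) *v x) = X *v coord_proj S x"
  "coord_proj T ((X + Y) *v x) = Y *v coord_proj T x"
  using disj
  by (simp_all add: matrix_vector_mult_add_rdistrib linear_add[OF linear_coord_proj]
      supported_on_mult_coord_proj[OF X] supported_on_mult_coord_proj[OF Y]
      coord_proj_ident[OF supported_on_mult_in] X Y Int_commute
      coord_proj_disjoint[OF supported_on_mult_in[OF X]] coord_proj_disjoint[OF supported_on_mult_in[OF Y]])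

lemma coord_proj_mult_left: "coord_proj S (X *v x) = (X + Y) *v coord_proj S x"
  and coord_proj_mult_right: "coord_proj T (Y *v x) = (X + Y) *v coord_proj T x"
  using disj
  by (simp_all add: matrix_vector_mult_add_rdistrib
      supported_on_mult_coord_proj[OF X] supported_on_mult_coord_proj[OF Y]
      coord_proj_ident[OF supported_on_mult_in] X Y Int_commute
      supported_on_mult_coord_proj_disjoint[OF X] supported_on_mult_coord_proj_disjoint[OF Y])

lemma supported_on_Un: "supported_on (S \<union> T) (X + Y)"
  unfolding supported_on_def
proof (intro allI impI)
  fix i j assume "(X + Y) $ i $ j \<noteq> 0"
  then have "X $ i $ j \<noteq> 0 \<or> Y $ i $ j \<noteq> 0"
    by auto
  then show "i \<in> S \<union> T \<and> j \<in> S \<union> T"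
    using X Y by (auto simp: supported_on_def)
qed

lemma dim_col_space_add:
  "dim (col_space (X + Y) C F) = dim (col_space X C F) + dim (col_space Y {} F)"
proof -
  let ?U = "col_space X C F" and ?V = "col_space Y {} F"
  let ?UV = "{x + y |x y. x \<in> ?U \<and> y \<in> ?V}"
  have sub: "subspace ?UV"
    by (intro subspace_sums subspace_col_space)
  have "col_space (X + Y) C F \<subseteq> ?UV"
    unfolding col_space_def[of "X + Y"]
  proof (rule span_minimal[OF _ sub], safe)
    fix x show "\<exists>u v. (X + Y) *v x = u + v \<and> u \<in> ?U \<and> v \<in> ?V"
      unfolding matrix_vector_mult_add_rdistrib col_space_def by (blast intro: span_base)
  next
    fix j assume "j \<in> C"
    then have "F j \<in> ?U" "0 \<in> ?V"
      unfolding col_space_def by (blast intro: span_base span_zero)+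
    then show "\<exists>u v. F j = u + v \<and> u \<in> ?U \<and> v \<in> ?V"
      by (metis add.right_neutral)
  qed
  moreover have "?U \<subseteq> col_space (X + Y) C F"
    unfolding col_space_def[of X]
  proof (rule span_minimal[OF _ subspace_col_space], safe)
    fix x
    have "X *v x = (X + Y) *v coord_proj S x"
      using coord_proj_mult_left[of x] coord_proj_ident[OF supported_on_mult_in[OF X]] by simp
    then show "X *v x \<in> col_space (X + Y) C F"
      unfolding col_space_def by (blast intro: span_base)
  next
    fix j assume "j \<in> C"
    then show "F j \<in> col_space (X + Y) C F"
      unfolding col_space_def by (blast intro: span_base)
  qed
  moreover have "?V \<subseteq> col_space (X + Y) C F"
    unfolding col_space_def[of Y]
  proof (rule span_minimal[OF _ subspace_col_space], safe)
    fix x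
    have "Y *v x = (X + Y) *v coord_proj T x"
      using coord_proj_mult_right[of x] coord_proj_ident[OF supported_on_mult_in[OF Y]] by simp
    then show "Y *v x \<in> col_space (X + Y) C F"
      unfolding col_space_def by (blast intro: span_base)
  qed
  ultimately have "col_space (X + Y) C F = ?UV"
    by (intro subset_antisym) (auto intro!: subspace_add[OF subspace_col_space])
  moreover have "?U \<subseteq> coord_space S" "?V \<subseteq> coord_space T"
    by (rule col_space_subset_coord_space; use X Y F in simp)+
  ultimately show ?thesis
    using dim_sum_disjoint_coord_spaces[OF subspace_col_space subspace_col_space _ _ disj] by simp
qed

lemma dim_stabilizable_subspace_add:
  assumes "transpose X = X" "transpose Y = Y"
  shows "dim (stabilizable_subspace (X + Y) C F)
    = dim (stabilizable_subspace X C F) + dim (stabilizable_subspace Y {} F)"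
proof -
  let ?W = "stabilizable_subspace (X + Y) C F"
  let ?U = "stabilizable_subspace X C F" and ?V = "stabilizable_subspace Y {} F"
  let ?UV = "{x + y |x y. x \<in> ?U \<and> y \<in> ?V}"
  have "transpose (X + Y) = X + Y"
    using assms by (simp add: transpose_def vec_eq_iff)
  \<comment> \<open>\<open>S \<union> T\<close> need not contain all indices; the column space bound
    shows that stabilizable states vanish on the remaining coordinates.\<close>
  then have "?W \<subseteq> coord_space (S \<union> T)"
    using stabilizable_subspace_subset_col_space
      col_space_subset_coord_space[OF supported_on_Un, of C F] F coord_space_mono[of S "S \<union> T"] by blast
  moreover have U: "?U \<subseteq> coord_space S" and V: "?V \<subseteq> coord_space T"
    using stabilizable_subspace_subset_col_space assms X Y F col_space_subset_coord_space
    by (metis order_trans, metis empty_iff order_trans)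
  moreover have projS: "coord_proj S x \<in> ?U" if "x \<in> ?W" for x
    by (rule stabilizable_subspace_map[OF linear_coord_proj _ _ that])
      (simp_all add: coord_proj_mult coord_proj_ident F)
  moreover have projT: "coord_proj T x \<in> ?V" if "x \<in> ?W" for x
  proof -
    \<comment> \<open>Projection to \<open>T\<close> kills all columns; inputs acting through zero
      columns amount to no inputs.\<close>
    have "coord_proj T x \<in> stabilizable_subspace Y C (\<lambda>_. 0)"
      by (rule stabilizable_subspace_map[OF linear_coord_proj _ _ that])
        (use F disj in \<open>auto simp: coord_proj_mult intro: coord_proj_disjoint\<close>)
    then show ?thesis
      by (simp add: stabilizable_subspace_def trajectory_def)
  qed
  moreover have "x \<in> ?W" if "x \<in> ?U" for x
  proof -
    have "coord_proj S x \<in> ?W"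
      by (rule stabilizable_subspace_map[OF linear_coord_proj coord_proj_mult_left _ that])
        (simp add: coord_proj_ident F)
    then show ?thesis
      using U that by (metis coord_proj_ident subsetD)
  qed
  moreover have "y \<in> ?W" if "y \<in> ?V" for y
  proof -
    have "coord_proj T y \<in> stabilizable_subspace (X + Y) {} F"
      by (rule stabilizable_subspace_map[OF linear_coord_proj coord_proj_mult_right _ that]) simp
    then have "y \<in> stabilizable_subspace (X + Y) {} F"
      using V that by (metis coord_proj_ident subsetD)
    then obtain u x where "trajectory (X + Y) {} F u x" "x 0 = y" "(x \<longlongrightarrow> 0) at_top"
      unfolding stabilizable_subspace_def by blast
    then show ?thesis
      unfolding stabilizable_subspace_def
      by (intro CollectI exI[of _ "\<lambda>_ _. 0"] exI[of _ x]) (simp add: trajectory_def)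
  qed
  ultimately have "?W = ?UV"
  proof (intro subset_antisym subsetI)
    fix x assume "x \<in> ?W"
    then have "x = coord_proj S x + coord_proj T x"
      using \<open>?W \<subseteq> coord_space (S \<union> T)\<close> coord_proj_add_disjoint[OF _ disj, of x] by auto
    then show "x \<in> ?UV"
      using \<open>x \<in> ?W\<close> projS projT by blast
  qed (auto intro!: subspace_add[OF subspace_stabilizable_subspace])
  then show ?thesis
    using dim_sum_disjoint_coord_spaces[OF subspace_stabilizable_subspace
        subspace_stabilizable_subspace U V disj] by simp
qed

end

section \<open>Structured matrices and reachability\<close>

definition block_realization :: "entry ^ 'n ^ 'n \<Rightarrow> 'n set \<Rightarrow> real ^ 'n ^ 'n \<Rightarrow> bool" where
  "block_realization A S X \<longleftrightarrow> sym_realization A X \<and> supported_on S X"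

definition separated :: "entry ^ 'n ^ 'n \<Rightarrow> 'n set \<Rightarrow> 'n set \<Rightarrow> bool" where
  "separated A S T \<longleftrightarrow> (\<forall>i\<in>S. \<forall>j\<in>T. A $ i $ j = Zero)"

text \<open>Every connected component of the graph of \<open>A\<close> restricted to \<open>S\<close> meets \<open>W\<close>.\<close>

definition reachable_from :: "entry ^ 'n ^ 'n \<Rightarrow> 'n set \<Rightarrow> 'n set \<Rightarrow> bool" where
  "reachable_from A S W \<longleftrightarrow> (\<forall>T\<subseteq>S. T \<noteq> {} \<longrightarrow> separated A T (S - T) \<longrightarrow> T \<inter> W \<noteq> {})"

lemma block_realization_symmetric: "block_realization A S X \<Longrightarrow> transpose X = X"
  by (simp add: block_realization_def sym_realization_def transpose_def vec_eq_iff)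

lemma block_realization_supported: "block_realization A S X \<Longrightarrow> supported_on S X"
  by (simp add: block_realization_def)

lemma block_realization_zero: "block_realization A S 0"
  by (simp add: block_realization_def sym_realization_def supported_on_def)

lemma block_realization_Un:
  assumes "block_realization A S X" "block_realization A T Y"
  shows "block_realization A (S \<union> T) (X + c *\<^sub>R Y)"
  unfolding block_realization_def sym_realization_def supported_on_def
proof (intro conjI allI impI)
  fix i j
  show "(X + c *\<^sub>R Y) $ i $ j = 0" if "A $ i $ j = Zero"
    using assms that by (simp add: block_realization_def sym_realization_def)
  show "(X + c *\<^sub>R Y) $ i $ j = (X + c *\<^sub>R Y) $ j $ i"
    using assms by (simp add: block_realization_def sym_realization_def)
  assume "(X + c *\<^sub>R Y) $ i $ j \<noteq> 0"
  then have "X $ i $ j \<noteq> 0 \<or> Y $ i $ j \<noteq> 0"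
    by auto
  then show "i \<in> S \<union> T" "j \<in> S \<union> T"
    using assms by (auto simp: block_realization_def supported_on_def)
qed

lemma block_realization_affine:
  assumes "block_realization A S X" "block_realization A S Y"
  shows "block_realization A S (X + t *\<^sub>R (Y - X))"
  using block_realization_Un[OF block_realization_Un[OF assms(1,1), of "- t"] assms(2), of t]
  by (simp add: algebra_simps)

lemma block_realization_compress:
  "block_realization A S X \<Longrightarrow> block_realization A T (compress T X)"
  by (auto simp: block_realization_def sym_realization_def supported_on_def compress_def)

lemma separated_sym:
  assumes "symmetrically_structured A" "separated A S T"
  shows "separated A T S"
proof -
  have "A $ i $ j = A $ j $ i" for i j
    using assms(1) unfolding symmetrically_structured_def by (metis transpose_def vec_lambda_beta)
  then show ?thesis
    using assms(2) unfolding separated_def by metis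
qed

lemma compress_add_separated:
  assumes "symmetrically_structured A" "separated A S T" "S \<inter> T = {}" "block_realization A (S \<union> T) X"
  shows "compress S X + compress T X = X"
  unfolding vec_eq_iff
proof (intro allI)
  fix i j
  have "X $ i $ j = 0" if "i \<in> S \<and> j \<in> T \<or> i \<in> T \<and> j \<in> S \<or> i \<notin> S \<union> T \<or> j \<notin> S \<union> T"
    using that assms(2,4) separated_sym[OF assms(1,2)]
    by (auto simp: block_realization_def sym_realization_def supported_on_def separated_def)
  then show "(compress S X + compress T X) $ i $ j = X $ i $ j"
    using assms(3) by (auto simp: compress_def)
qed

lemma separated_blocks_separated:
  "block_realization A S X \<Longrightarrow> block_realization A T Y \<Longrightarrow> S \<inter> T = {} \<Longrightarrow>
    (\<And>j. j \<in> C \<Longrightarrow> F j \<in> coord_space S) \<Longrightarrow> separated_blocks S T X Y C F"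
  by (simp add: separated_blocks_def block_realization_def)

section \<open>Controlled realizations of maximal rank\<close>

lemma exists_max_rank_block_realization:
  fixes A :: "entry ^ 'n::finite ^ 'n"
  obtains X where "block_realization A S X" "\<And>Y. block_realization A S Y \<Longrightarrow> rank Y \<le> rank X"
proof -
  have "\<exists>X. block_realization A S X \<and> (\<forall>Y. block_realization A S Y \<longrightarrow> rank Y \<le> rank X)"
  proof (rule ex_has_greatest_nat)
    show "block_realization A S 0"
      by (rule block_realization_zero)
    show "\<forall>X. block_realization A S X \<longrightarrow> rank X < Suc CARD('n)"
      by (metis rank_bound min.idem less_Suc_eq_le)
  qed
  then show ?thesis
    using that by blast
qed

text \<open>The factor \<open>c\<close> avoids 0 and all quotients of an eigenvalue of
  \<open>X\<close> by one of \<open>Y\<close>. Then \<open>X\<close> and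
  \<open>c *\<^sub>R Y\<close> share no nonzero eigenvalue, so a nonzero mode of the sum lives in
  one block only and cannot hide from \<open>w + w'\<close> by cancellation between the
  blocks.\<close>

lemma controls_nonzero_modes_add:
  assumes X: "transpose X = X" "supported_on S X" and Y: "transpose Y = Y" "supported_on T Y"
    and disj: "S \<inter> T = {}" and w: "w \<in> coord_space S" "w' \<in> coord_space T"
    and cX: "controls_nonzero_modes X {()} (\<lambda>_. w)" and cY: "controls_nonzero_modes Y {()} (\<lambda>_. w')"
  obtains c where "c \<noteq> 0" "controls_nonzero_modes (X + c *\<^sub>R Y) {()} (\<lambda>_. w + w')"
proof -
  let ?L = "\<lambda>X :: real ^ 'n ^ 'n. {l. \<exists>v. v \<noteq> 0 \<and> X *v v = l *\<^sub>R v}"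
  have "finite (insert 0 ((\<lambda>(a, b). a / b) ` (?L X \<times> ?L Y)))"
    using finite_symmetric_eigenvalues X(1) Y(1) by blast
  then obtain c where c: "c \<notin> insert 0 ((\<lambda>(a, b). a / b) ` (?L X \<times> ?L Y))"
    using ex_new_if_finite[OF infinite_UNIV_char_0] by blast
  interpret separated_blocks S T X "c *\<^sub>R Y" "{()}" "\<lambda>_. w"
    using X(2) Y(2) disj w(1) by unfold_locales (auto simp: supported_on_def)
  have "v = 0" if v: "l \<noteq> 0" "(X + c *\<^sub>R Y) *v v = l *\<^sub>R v" "(w + w') \<bullet> v = 0" for v l
  proof -
    let ?x = "coord_proj S v" and ?y = "coord_proj T v"
    have "l *\<^sub>R v \<in> coord_space (S \<union> T)"
      using supported_on_mult_in[OF supported_on_Un] v(2) by metis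
    then have "v \<in> coord_space (S \<union> T)"
      using v(1) by (simp add: coord_space_def)
    then have sum: "?x + ?y = v"
      using coord_proj_add_disjoint disj by blast
    have x: "X *v ?x = l *\<^sub>R ?x" and y': "(c *\<^sub>R Y) *v ?y = l *\<^sub>R ?y"
      using coord_proj_mult[of v] v(2) by (simp_all add: linear_scale[OF linear_coord_proj])
    then have y: "Y *v ?y = (l / c) *\<^sub>R ?y"
    proof -
      have "Y *v ?y = (1 / c) *\<^sub>R ((c *\<^sub>R Y) *v ?y)"
        using c by (simp flip: scaleR_matrix_vector_assoc)
      then show ?thesis
        by (simp add: y')
    qed
    have wv: "w \<bullet> ?x + w' \<bullet> ?y = 0"
      using v(3) w disj coord_space_inner_disjoint[OF w(1) coord_proj_in, of T v]
        coord_space_inner_disjoint[OF w(2) coord_proj_in, of S v] Int_commute[of S T]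
      by (subst (asm) sum[symmetric]) (auto simp: inner_add_left inner_add_right)
    have "?x = 0 \<or> ?y = 0"
    proof (rule ccontr)
      assume "\<not> (?x = 0 \<or> ?y = 0)"
      then have "l \<in> ?L X" "l / c \<in> ?L Y"
        using x y by blast+
      then have "l / (l / c) \<in> (\<lambda>(a, b). a / b) ` (?L X \<times> ?L Y)"
        by blast
      then show False
        using c v(1) by simp
    qed
    moreover have "?y = 0" if "?x = 0"
      using cY[unfolded controls_nonzero_modes_def, rule_format, OF _ y] wv that v(1) c by simp
    moreover have "?x = 0" if "?y = 0"
      using cX[unfolded controls_nonzero_modes_def, rule_format, OF _ x] wv that v(1) by simp
    ultimately show "v = 0"
      using sum by auto
  qed
  then have "controls_nonzero_modes (X + c *\<^sub>R Y) {()} (\<lambda>_. w + w')"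
    unfolding controls_nonzero_modes_def by blast
  then show ?thesis
    using that c by blast
qed

text \<open>If an eigenvector \<open>v\<close> of \<open>Z\<close> vanishes at \<open>i\<close>, then deleting row and column \<open>i\<close> leaves an
  eigenvector of the smaller matrix that is orthogonal to the deleted column.\<close>

lemma controls_nonzero_modes_axis:
  assumes Z: "transpose Z = Z" "supported_on S Z" and "i \<in> S"
    and ctrl: "controls_nonzero_modes (compress (S - {i}) Z) {()} (\<lambda>_. coord_proj (S - {i}) (column i Z))"
  shows "controls_nonzero_modes Z {()} (\<lambda>_. axis i 1)"
proof -
  have "v = 0" if v: "l \<noteq> 0" "Z *v v = l *\<^sub>R v" "axis i 1 \<bullet> v = 0" for v l
  proof -
    let ?S = "S - {i}"
    have vi: "v $ i = 0"
      using v(3) by (simp add: inner_axis')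
    have "l *\<^sub>R v \<in> coord_space S"
      using supported_on_mult_in[OF Z(2)] v(2) by metis
    then have "v \<in> coord_space S"
      using v(1) by (simp add: coord_space_def)
    then have vS: "v \<in> coord_space ?S"
      using vi by (auto simp: coord_space_def)
    have "compress ?S Z *v v = coord_proj ?S (Z *v v)"
    proof -
      have "(\<Sum>b\<in>UNIV. compress ?S Z $ a $ b * v $ b) = (\<Sum>b\<in>UNIV. Z $ a $ b * v $ b)" if "a \<in> ?S" for a
        by (rule sum.cong) (use that vS in \<open>auto simp: compress_def coord_space_def\<close>)
      then show ?thesis
        by (auto simp: vec_eq_iff coord_proj_def matrix_vector_mult_def compress_def intro!: sum.neutral)
    qed
    also have "\<dots> = l *\<^sub>R v"
      using coord_proj_ident[OF vS] by (simp add: v(2) linear_scale[OF linear_coord_proj])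
    finally have "compress ?S Z *v v = l *\<^sub>R v" .
    moreover have "coord_proj ?S (column i Z) \<bullet> v = 0"
    proof -
      have "Z $ a $ i = Z $ i $ a" for a
        using Z(1) by (metis transpose_def vec_lambda_beta)
      then have "coord_proj ?S (column i Z) \<bullet> v = (\<Sum>a\<in>UNIV. Z $ i $ a * v $ a)"
        unfolding inner_vec_def inner_real_def
        by (intro sum.cong) (use vS in \<open>auto simp: coord_proj_def column_def coord_space_def\<close>)
      also have "\<dots> = (Z *v v) $ i"
        by (simp add: matrix_vector_mult_def)
      finally show ?thesis
        using v(2) vi by simp
    qed
    ultimately show "v = 0"
      using ctrl v(1) unfolding controls_nonzero_modes_def by blast
  qed
  then show ?thesis
    unfolding controls_nonzero_modes_def by blast
qed

text \<open>The inductive step of the next theorem for a connected block: a vertex \<open>i\<close> is removed and its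
  neighbours become the inputs of what remains.\<close>

lemma exists_max_rank_controlled_by_axis:
  fixes A :: "entry ^ 'n ^ 'n"
  assumes A: "symmetrically_structured A" and "i \<in> S"
    and X: "block_realization A (S - {i}) X"
      "\<And>Y. block_realization A (S - {i}) Y \<Longrightarrow> rank Y \<le> rank X"
    and w: "w \<in> coord_space {j \<in> S - {i}. A $ j $ i = Star}"
    and ctrl: "controls_nonzero_modes X {()} (\<lambda>_. w)"
  shows "\<exists>Z. block_realization A S Z \<and> (\<forall>Y. block_realization A S Y \<longrightarrow> rank Y \<le> rank Z) \<and>
    controls_nonzero_modes Z {()} (\<lambda>_. axis i 1)"
proof -
  let ?S = "S - {i}"
  obtain Y where Y: "block_realization A S Y" "\<And>Z. block_realization A S Z \<Longrightarrow> rank Z \<le> rank Y"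
    using exists_max_rank_block_realization by blast
  \<comment> \<open>\<open>P\<close> borders \<open>X\<close> with \<open>w\<close> as row and
    column \<open>i\<close>. It witnesses control, while \<open>Y\<close> witnesses maximal rank on
    the larger block; a generic point of the line through them has both properties.\<close>
  define P :: "real ^ 'n ^ 'n" where
    "P = (\<chi> a b. X $ a $ b + (if b = i then w $ a else 0) + (if a = i then w $ b else 0))"
  have wi: "w $ a = 0" if "a \<notin> ?S \<or> A $ a $ i = Zero \<or> A $ i $ a = Zero" for a
  proof -
    have "A $ a $ i = A $ i $ a"
      using A unfolding symmetrically_structured_def by (metis transpose_def vec_lambda_beta)
    then show ?thesis
      using that w by (auto simp: coord_space_def)
  qed
  have Xi: "X $ a $ b = 0" if "a \<notin> ?S \<or> b \<notin> ?S" for a b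
    using that block_realization_supported[OF X(1)] unfolding supported_on_def by blast
  have P: "block_realization A S P"
    unfolding block_realization_def sym_realization_def supported_on_def
  proof (intro conjI allI impI)
    fix a b
    show "P $ a $ b = 0" if "A $ a $ b = Zero"
      using X(1) that wi[of a] wi[of b] by (auto simp: P_def block_realization_def sym_realization_def)
    show "P $ a $ b = P $ b $ a"
      using X(1) by (auto simp: P_def block_realization_def sym_realization_def)
    show "a \<in> S" "b \<in> S" if "P $ a $ b \<noteq> 0"
      using that wi[of a] wi[of b] Xi[of a b] \<open>i \<in> S\<close> by (auto simp: P_def split: if_splits)
  qed
  have cP: "compress ?S P = X" "coord_proj ?S (column i P) = w"
    using wi Xi by (auto simp: compress_def P_def vec_eq_iff coord_proj_def column_def)
  define Z where "Z t = P + t *\<^sub>R (Y - P)" for t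
  have Z: "block_realization A S (Z t)" for t
    unfolding Z_def by (rule block_realization_affine[OF P Y(1)])
  have polyZ: "real_polynomial_function (\<lambda>t. Z t $ a $ b)" for a b
    by (simp add: Z_def real_polynomial_function_line)
  let ?c = "\<lambda>t. compress ?S (Z t)" and ?w = "\<lambda>t (_::unit). coord_proj ?S (column i (Z t))"
  have "\<exists>t. rank Y \<le> dim ((\<lambda>y. Z t *v y) ` UNIV) \<and>
      rank X \<le> dim (krylov (?c t) (?w t) ` (UNIV \<times> {()}))"
  proof (rule common_generic_point)
    show "real_polynomial_function (\<lambda>t. (Z t *v y) $ k)" for y k
      by (intro real_polynomial_function_matrix_vector_mult polyZ real_polynomial_function.intros(2))
    show "real_polynomial_function (\<lambda>t. krylov (?c t) (?w t) q $ k)" for q k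
    proof (rule real_polynomial_function_krylov)
      show "real_polynomial_function (\<lambda>t. ?c t $ a $ b)" for a b
        by (cases "a \<in> ?S \<and> b \<in> ?S") (auto simp: compress_def polyZ)
      show "real_polynomial_function (\<lambda>t. ?w t (snd q) $ a)" for a
        by (cases "a \<in> ?S") (auto simp: coord_proj_def column_def polyZ)
    qed
    show "rank Y \<le> dim ((\<lambda>y. Z 1 *v y) ` UNIV)"
      by (simp add: Z_def rank_dim_range)
    show "rank X \<le> dim (krylov (?c 0) (?w 0) ` (UNIV \<times> {()}))"
      using rank_le_krylov_if_controls_nonzero_modes[OF block_realization_symmetric[OF X(1)] ctrl]
      by (simp add: Z_def cP)
  qed
  then obtain t where t: "rank Y \<le> rank (Z t)" "rank X \<le> dim (krylov (?c t) (?w t) ` (UNIV \<times> {()}))"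
    by (auto simp: rank_dim_range)
  have c: "block_realization A ?S (?c t)"
    using block_realization_compress[OF Z] .
  \<comment> \<open>Maximality of \<open>rank X\<close> on the smaller block is used here: the
    compressed matrix has at most that rank, so the Krylov bound inherited from \<open>X\<close> is
    sufficient for it.\<close>
  then have "controls_nonzero_modes (?c t) {()} (?w t)"
    using t(2) X(2)[OF c] by (intro controls_nonzero_modes_if_krylov block_realization_symmetric[OF c]) simp
  then have "controls_nonzero_modes (Z t) {()} (\<lambda>_. axis i 1)"
    using block_realization_symmetric[OF Z] block_realization_supported[OF Z] \<open>i \<in> S\<close>
    by (intro controls_nonzero_modes_axis)
  then show ?thesis
    using Z[of t] t(1) Y(2) order_trans by blast
qed

text \<open>If \<open>S\<close> splits, the realizations of the two parts are combined after
  rescaling one of them. If \<open>S\<close> is connected, a vertex of \<open>W\<close> is deleted.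
  \<open>W\<close> varies in the induction because the neighbours of the deleted vertex take its
  place.\<close>

theorem exists_max_rank_controlled_realization:
  fixes A :: "entry ^ 'n ^ 'n"
  assumes A: "symmetrically_structured A" and "reachable_from A S W"
  shows "\<exists>X w. block_realization A S X \<and> (\<forall>Y. block_realization A S Y \<longrightarrow> rank Y \<le> rank X) \<and>
    w \<in> coord_space (S \<inter> W) \<and> controls_nonzero_modes X {()} (\<lambda>_. w)"
  using assms(2)
proof (induction "card S" arbitrary: S W rule: less_induct)
  case less
  consider "S = {}" | (split) T where "T \<subseteq> S" "T \<noteq> {}" "T \<noteq> S" "separated A T (S - T)"
    | (conn) "S \<noteq> {}" "\<And>T. T \<subseteq> S \<Longrightarrow> T \<noteq> {} \<Longrightarrow> separated A T (S - T) \<Longrightarrow> T = S"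
    by blast
  then show ?case
  proof cases
    case 1
    have "X = 0" if "block_realization A S X" for X
      using block_realization_supported[OF that] by (auto simp: 1 supported_on_def vec_eq_iff)
    then have "rank X \<le> rank (0 :: real ^ 'n ^ 'n)" if "block_realization A S X" for X
      using that by (metis order_refl)
    moreover have "controls_nonzero_modes (0 :: real ^ 'n ^ 'n) {()} (\<lambda>_. 0)"
      by (simp add: controls_nonzero_modes_def)
    moreover have "0 \<in> coord_space (S \<inter> W)"
      by (rule subspace_0[OF subspace_coord_space])
    ultimately show ?thesis
      using block_realization_zero[of A S] by blast
  next
    case split
    let ?T = "S - T"
    have sep': "separated A ?T T"
      using separated_sym[OF A split(4)] .
    have TT: "T \<union> ?T = S" "T \<inter> ?T = {}"
      using split(1) by auto
    have "reachable_from A T W"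
      unfolding reachable_from_def
    proof (intro allI impI)
      fix U assume U: "U \<subseteq> T" "U \<noteq> {}" "separated A U (T - U)"
      then have "separated A U (S - U)"
        using split(4) unfolding separated_def by blast
      then show "U \<inter> W \<noteq> {}"
        using U less.prems split(1) unfolding reachable_from_def by blast
    qed
    moreover have "card T < card S"
      using split(1,3) by (simp add: psubset_card_mono psubsetI)
    ultimately obtain X w where X: "block_realization A T X"
        "\<And>Y. block_realization A T Y \<Longrightarrow> rank Y \<le> rank X"
        "w \<in> coord_space (T \<inter> W)" "controls_nonzero_modes X {()} (\<lambda>_. w)"
      using less.hyps[of T W] by auto
    have "reachable_from A ?T W"
      unfolding reachable_from_def
    proof (intro allI impI)
      fix U assume U: "U \<subseteq> ?T" "U \<noteq> {}" "separated A U (?T - U)"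
      then have "separated A U (S - U)"
        using sep' unfolding separated_def by blast
      then show "U \<inter> W \<noteq> {}"
        using U less.prems unfolding reachable_from_def by blast
    qed
    moreover have "card ?T < card S"
      using split(1,2) by (intro psubset_card_mono) auto
    ultimately obtain X' w' where X': "block_realization A ?T X'"
        "\<And>Y. block_realization A ?T Y \<Longrightarrow> rank Y \<le> rank X'"
        "w' \<in> coord_space (?T \<inter> W)" "controls_nonzero_modes X' {()} (\<lambda>_. w')"
      using less.hyps[of ?T W] by auto
    have ww: "w \<in> coord_space T" "w' \<in> coord_space ?T"
      using X(3) X'(3) coord_space_mono[of "T \<inter> W" T] coord_space_mono[of "?T \<inter> W" ?T] by auto
    obtain c where c: "c \<noteq> 0" "controls_nonzero_modes (X + c *\<^sub>R X') {()} (\<lambda>_. w + w')"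
      using controls_nonzero_modes_add[OF block_realization_symmetric[OF X(1)]
        block_realization_supported[OF X(1)] block_realization_symmetric[OF X'(1)]
        block_realization_supported[OF X'(1)] TT(2) ww X(4) X'(4)] by blast
    have cX': "block_realization A ?T (c *\<^sub>R X')"
      using block_realization_affine[OF block_realization_zero X'(1), of c] by simp
    have rank_add: "rank (Y + Y') = rank Y + rank Y'"
      if "block_realization A T Y" "block_realization A ?T Y'" for Y Y'
    proof -
      interpret separated_blocks T ?T Y Y' "{} :: unit set" "\<lambda>_. 0"
        using that TT(2) by (intro separated_blocks_separated) auto
      show ?thesis
        using dim_col_space_add by (simp add: dim_col_space_empty)
    qed
    have "rank (c *\<^sub>R X') = rank X'"
    proof -
      have "range ((*v) (c *\<^sub>R X')) = (\<lambda>x. c *\<^sub>R x) ` range ((*v) X')"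
        by (simp add: image_image scaleR_matrix_vector_assoc)
      then show ?thesis
        using c(1) by (simp add: rank_dim_range dim_image_eq linear_scale_self inj_on_def)
    qed
    then have "rank Y \<le> rank (X + c *\<^sub>R X')" if Y: "block_realization A S Y" for Y
    proof -
      have "Y = compress T Y + compress ?T Y"
        using compress_add_separated[OF A split(4) TT(2)] Y TT(1) by simp
      then have "rank Y = rank (compress T Y) + rank (compress ?T Y)"
        using rank_add block_realization_compress[OF Y] by metis
      also have "\<dots> \<le> rank X + rank (c *\<^sub>R X')"
        using X(2) X'(2) block_realization_compress[OF Y] \<open>rank (c *\<^sub>R X') = rank X'\<close>
        by (simp add: add_mono)
      finally show ?thesis
        using rank_add[OF X(1) cX'] by simp
    qed
    moreover have "w + w' \<in> coord_space (S \<inter> W)"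
      using X(3) X'(3) split(1) by (auto simp: coord_space_def)
    moreover have "block_realization A S (X + c *\<^sub>R X')"
      using block_realization_Un[OF X(1) X'(1)] TT(1) by metis
    ultimately show ?thesis
      using c(2) by blast
  next
    case conn
    have "separated A S (S - S)"
      by (simp add: separated_def)
    then obtain i where i: "i \<in> S" "i \<in> W"
      using less.prems conn(1) unfolding reachable_from_def by blast
    let ?W = "{j \<in> S - {i}. A $ j $ i = Star}"
    \<comment> \<open>A part of \<open>S - {i}\<close> that is separated from the rest and contains
      no neighbour of \<open>i\<close> would be separated from the rest of \<open>S\<close>, against
      connectedness.\<close>
    have "reachable_from A (S - {i}) ?W"
      unfolding reachable_from_def
    proof (intro allI impI notI)
      fix T assume T: "T \<subseteq> S - {i}" "T \<noteq> {}" "separated A T (S - {i} - T)" "T \<inter> ?W = {}"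
      have "A $ j $ i = Zero" if "j \<in> T" for j
        using that T(1,4) entry.exhaust by blast
      then have "separated A T (S - T)"
        using T(3) unfolding separated_def by blast
      then show False
        using conn(2)[of T] T(1,2) i(1) by blast
    qed
    moreover have "card (S - {i}) < card S"
      using i(1) by (intro psubset_card_mono) auto
    moreover have "(S - {i}) \<inter> ?W = ?W"
      by blast
    ultimately obtain X w where X: "block_realization A (S - {i}) X"
        "\<And>Y. block_realization A (S - {i}) Y \<Longrightarrow> rank Y \<le> rank X"
        "w \<in> coord_space ?W" "controls_nonzero_modes X {()} (\<lambda>_. w)"
      using less.hyps[of "S - {i}" ?W] by auto
    moreover have "axis i 1 \<in> coord_space (S \<inter> W)"
      using i by (auto simp: coord_space_def axis_def)
    ultimately show ?thesis
      using exists_max_rank_controlled_by_axis[OF A i(1) X] by blast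
  qed
qed

section \<open>Maximal dimensions over realizations\<close>

text \<open>Kept generic in \<open>\<Phi>\<close> so that additivity over separated blocks is proved
  once, for both \<open>col_space\<close> and \<open>stabilizable_subspace\<close>.\<close>

definition max_dim ::
    "(real ^ 'n ^ 'n \<Rightarrow> 'c set \<Rightarrow> ('c \<Rightarrow> real ^ 'n) \<Rightarrow> (real ^ 'n) set) \<Rightarrow>
      entry ^ 'n ^ 'n \<Rightarrow> 'n set \<Rightarrow> 'c set \<Rightarrow> ('c \<Rightarrow> entry ^ 'n) \<Rightarrow> nat" where
  "max_dim \<Phi> A S C F = Max {dim (\<Phi> X C G) | X G. block_realization A S X \<and> col_realization C F G}"

definition input_rows :: "'c set \<Rightarrow> ('c \<Rightarrow> entry ^ 'n) \<Rightarrow> 'n set" where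
  "input_rows C F = {i. \<exists>j\<in>C. F j $ i = Star}"

lemma finite_realization_dims:
  fixes \<Phi> :: "real ^ 'n ^ 'n \<Rightarrow> 'c set \<Rightarrow> ('c \<Rightarrow> real ^ 'n) \<Rightarrow> (real ^ 'n) set"
  shows "finite {dim (\<Phi> X C G) | X G. block_realization A S X \<and> col_realization C F G}"
proof (rule finite_subset)
  have "dim U \<le> CARD('n)" for U :: "(real ^ 'n) set"
    using dim_subset_UNIV[of U] by simp
  then show "{dim (\<Phi> X C G) | X G. block_realization A S X \<and> col_realization C F G} \<subseteq> {..CARD('n)}"
    by auto
qed simp

lemma dim_le_max_dim:
  "block_realization A S X \<Longrightarrow> col_realization C F G \<Longrightarrow> dim (\<Phi> X C G) \<le> max_dim \<Phi> A S C F"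
  unfolding max_dim_def by (rule Max_ge[OF finite_realization_dims]) blast

lemma max_dim_attained:
  obtains X G where "block_realization A S X" "col_realization C F G" "dim (\<Phi> X C G) = max_dim \<Phi> A S C F"
proof -
  have "col_realization C F (\<lambda>_. 0)"
    by (simp add: col_realization_def)
  then have "{dim (\<Phi> X C G) | X G. block_realization A S X \<and> col_realization C F G} \<noteq> {}"
    using block_realization_zero by blast
  then have "max_dim \<Phi> A S C F \<in> {dim (\<Phi> X C G) | X G. block_realization A S X \<and> col_realization C F G}"
    unfolding max_dim_def by (rule Max_in[OF finite_realization_dims])
  then show ?thesis
    using that by auto
qed

lemma m_dim_eq_max_dim: "m_dim A C F = max_dim stabilizable_subspace A UNIV C F"
  by (simp add: m_dim_def max_dim_def block_realization_def supported_on_def)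

lemma col_realization_coord_space:
  assumes "col_realization C F G" "input_rows C F \<subseteq> S" "j \<in> C"
  shows "G j \<in> coord_space S"
  unfolding coord_space_def
proof (intro CollectI allI impI)
  fix i assume "i \<notin> S"
  then have "F j $ i \<noteq> Star"
    using assms(2,3) by (auto simp: input_rows_def)
  then have "F j $ i = Zero"
    using entry.exhaust by blast
  then show "G j $ i = 0"
    using assms(1,3) by (simp add: col_realization_def)
qed

lemma max_dim_Un:
  assumes A: "symmetrically_structured A" and sep: "separated A S T" "S \<inter> T = {}"
    and F: "input_rows C F \<subseteq> S"
    and add: "\<And>X Y G. separated_blocks S T X Y C G \<Longrightarrow> transpose X = X \<Longrightarrow> transpose Y = Y \<Longrightarrow>
      dim (\<Phi> (X + Y) C G) = dim (\<Phi> X C G) + dim (\<Phi> Y {} G)"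
    and empty: "\<And>Y G G'. \<Phi> Y {} G = \<Phi> Y {} G'"
  shows "max_dim \<Phi> A (S \<union> T) C F = max_dim \<Phi> A S C F + max_dim \<Phi> A T {} F"
proof -
  have *: "dim (\<Phi> (X + Y) C G) = dim (\<Phi> X C G) + dim (\<Phi> Y {} G)"
    if "block_realization A S X" "block_realization A T Y" "col_realization C F G" for X Y G
    using that separated_blocks_separated[OF that(1,2) sep(2)] col_realization_coord_space[OF that(3) F]
      block_realization_symmetric by (intro add) blast+
  have none: "col_realization {} F G" for G
    by (simp add: col_realization_def)
  show ?thesis
  proof (rule antisym)
    obtain X G where X: "block_realization A (S \<union> T) X" "col_realization C F G"
        "dim (\<Phi> X C G) = max_dim \<Phi> A (S \<union> T) C F"
      by (rule max_dim_attained)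
    have "dim (\<Phi> X C G) = dim (\<Phi> (compress S X) C G) + dim (\<Phi> (compress T X) {} G)"
      using *[OF block_realization_compress[OF X(1)] block_realization_compress[OF X(1)] X(2)]
        compress_add_separated[OF A sep X(1)] by simp
    also have "\<dots> \<le> max_dim \<Phi> A S C F + max_dim \<Phi> A T {} F"
      by (intro add_mono dim_le_max_dim block_realization_compress[OF X(1)] X(2) none)
    finally show "max_dim \<Phi> A (S \<union> T) C F \<le> max_dim \<Phi> A S C F + max_dim \<Phi> A T {} F"
      by (simp add: X(3))
  next
    obtain X G where X: "block_realization A S X" "col_realization C F G"
        "dim (\<Phi> X C G) = max_dim \<Phi> A S C F"
      by (rule max_dim_attained)
    obtain Y G' where Y: "block_realization A T Y" "col_realization {} F G'"
        "dim (\<Phi> Y {} G') = max_dim \<Phi> A T {} F"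
      by (rule max_dim_attained)
    \<comment> \<open>The two maximizers come with different column families; on \<open>T\<close> no
      column is used, so \<open>G'\<close> may be replaced by \<open>G\<close>.\<close>
    have "max_dim \<Phi> A S C F + max_dim \<Phi> A T {} F = dim (\<Phi> (X + Y) C G)"
      using *[OF X(1) Y(1) X(2)] X(3) Y(3) empty[of Y G G'] by simp
    also have "\<dots> \<le> max_dim \<Phi> A (S \<union> T) C F"
      using block_realization_Un[OF X(1) Y(1), of 1] X(2) by (intro dim_le_max_dim) auto
    finally show "max_dim \<Phi> A S C F + max_dim \<Phi> A T {} F \<le> max_dim \<Phi> A (S \<union> T) C F" .
  qed
qed

lemma max_dim_col_space_Un:
  assumes "symmetrically_structured A" "separated A S T" "S \<inter> T = {}" "input_rows C F \<subseteq> S"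
  shows "max_dim col_space A (S \<union> T) C F = max_dim col_space A S C F + max_dim col_space A T {} F"
  by (rule max_dim_Un[OF assms]) (erule separated_blocks.dim_col_space_add, simp add: col_space_def)

lemma max_dim_stabilizable_subspace_Un:
  assumes "symmetrically_structured A" "separated A S T" "S \<inter> T = {}" "input_rows C F \<subseteq> S"
  shows "max_dim stabilizable_subspace A (S \<union> T) C F
    = max_dim stabilizable_subspace A S C F + max_dim stabilizable_subspace A T {} F"
  by (rule max_dim_Un[OF assms])
    (rule separated_blocks.dim_stabilizable_subspace_add, assumption+,
      simp add: stabilizable_subspace_def trajectory_def)

lemma max_dim_stabilizable_subspace_le:
  "max_dim stabilizable_subspace A S C F \<le> max_dim col_space A S C F"
proof -
  obtain X G where X: "block_realization A S X" "col_realization C F G"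
      "dim (stabilizable_subspace X C G) = max_dim stabilizable_subspace A S C F"
    by (rule max_dim_attained)
  then have "dim (stabilizable_subspace X C G) \<le> dim (col_space X C G)"
    by (intro dim_subset stabilizable_subspace_subset_col_space block_realization_symmetric)
  also have "\<dots> \<le> max_dim col_space A S C F"
    using X by (intro dim_le_max_dim)
  finally show ?thesis
    by (simp add: X(3))
qed

text \<open>The images \<open>X *v y\<close> and the columns form one family over a disjoint sum of
  index sets, which makes the column space accessible to
  \<open>common_generic_point\<close>.\<close>

lemma real_polynomial_function_col_space_family:
  fixes X Y :: "real ^ 'n ^ 'n"
  shows "real_polynomial_function
    (\<lambda>t. case_sum (\<lambda>y. (X + t *\<^sub>R (Y - X)) *v y) (\<lambda>j. G j + t *\<^sub>R (H j - G j)) q $ k)"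
  by (cases q) (simp_all add: real_polynomial_function_line
      real_polynomial_function_matrix_vector_mult real_polynomial_function.intros(2))

lemma dim_col_space_family: "dim (case_sum (\<lambda>y. X *v y) G ` (UNIV <+> C)) = dim (col_space X C G)"
proof -
  have "case_sum (\<lambda>y. X *v y) G ` (UNIV <+> C) = range ((*v) X) \<union> G ` C"
    by (force simp: Plus_def image_Un image_image)
  then show ?thesis
    by (simp add: col_space_def)
qed

lemma col_realization_affine:
  "col_realization C F G \<Longrightarrow> col_realization C F H \<Longrightarrow> col_realization C F (\<lambda>j. G j + t *\<^sub>R (H j - G j))"
  by (simp add: col_realization_def)

text \<open>A single controlling column can be distributed over the columns of \<open>F\<close>, because a vector
  orthogonal to all the pieces is orthogonal to their sum.\<close>

lemma controls_nonzero_modes_split_column: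
  assumes "finite C" "w \<in> coord_space (input_rows C F)" "controls_nonzero_modes X {()} (\<lambda>_. w)"
  obtains G where "col_realization C F G" "controls_nonzero_modes X C G"
proof -
  define c where "c i = (SOME j. j \<in> C \<and> F j $ i = Star)" for i
  have c: "c i \<in> C" "F (c i) $ i = Star" if "i \<in> input_rows C F" for i
    using that someI_ex[of "\<lambda>j. j \<in> C \<and> F j $ i = Star"] by (auto simp: c_def input_rows_def)
  define G where "G j = (\<chi> i. if i \<in> input_rows C F \<and> c i = j then w $ i else 0)" for j
  have "col_realization C F G"
    using c by (auto simp: col_realization_def G_def)
  moreover have "(\<Sum>j\<in>C. G j) = w"
  proof -
    have "(\<Sum>j\<in>C. G j $ i) = w $ i" for i
    proof (cases "i \<in> input_rows C F")
      case True
      then have "(\<Sum>j\<in>C. G j $ i) = (\<Sum>j\<in>C. if c i = j then w $ i else 0)"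
        by (simp add: G_def)
      then show ?thesis
        using True c assms(1) by simp
    next
      case False
      then show ?thesis
        using assms(2) by (simp add: G_def coord_space_def)
    qed
    then show ?thesis
      by (simp add: vec_eq_iff)
  qed
  then have "w \<bullet> v = 0" if "\<forall>j\<in>C. G j \<bullet> v = 0" for v
    using that by (auto simp flip: \<open>(\<Sum>j\<in>C. G j) = w\<close> simp: inner_sum_left)
  then have "controls_nonzero_modes X C G"
    using assms(3) unfolding controls_nonzero_modes_def by blast
  ultimately show ?thesis
    using that by blast
qed

text \<open>A controlled realization of maximal rank is joined by a line to one with the largest
  column space. At a generic point the column space is still largest and, as the rank cannot exceed
  \<open>rank X\<close>, all nonzero modes are controlled.\<close>

lemma max_dim_stabilizable_subspace_reachable:
  fixes A :: "entry ^ 'n ^ 'n"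
  assumes A: "symmetrically_structured A" and "finite C"
    and reach: "reachable_from A S (input_rows C F)"
  shows "max_dim stabilizable_subspace A S C F = max_dim col_space A S C F"
proof (rule antisym[OF max_dim_stabilizable_subspace_le])
  obtain X w where X: "block_realization A S X" "\<And>Y. block_realization A S Y \<Longrightarrow> rank Y \<le> rank X"
      "w \<in> coord_space (S \<inter> input_rows C F)" "controls_nonzero_modes X {()} (\<lambda>_. w)"
    using exists_max_rank_controlled_realization[OF A reach] by blast
  have "w \<in> coord_space (input_rows C F)"
    using X(3) coord_space_mono[of "S \<inter> input_rows C F"] by blast
  then obtain G where G: "col_realization C F G" "controls_nonzero_modes X C G"
    using controls_nonzero_modes_split_column[OF \<open>finite C\<close> _ X(4)] by blast
  obtain Y H where Y: "block_realization A S Y" "col_realization C F H"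
      "dim (col_space Y C H) = max_dim col_space A S C F"
    by (rule max_dim_attained)
  define Z where "Z t = X + t *\<^sub>R (Y - X)" for t
  define K where "K t j = G j + t *\<^sub>R (H j - G j)" for t j
  have K01: "K 0 = G" "K 1 = H"
    by (simp_all add: K_def fun_eq_iff)
  have Z: "block_realization A S (Z t)" and K: "col_realization C F (K t)" for t
    unfolding Z_def K_def by (intro block_realization_affine X Y col_realization_affine G)+
  have "\<exists>t. max_dim col_space A S C F \<le> dim (case_sum (\<lambda>y. Z t *v y) (K t) ` (UNIV <+> C)) \<and>
      rank X \<le> dim (krylov (Z t) (K t) ` (UNIV \<times> C))"
  proof (rule common_generic_point)
    show "real_polynomial_function (\<lambda>t. case_sum (\<lambda>y. Z t *v y) (K t) q $ k)" for q k
      unfolding Z_def K_def by (rule real_polynomial_function_col_space_family)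
    show "real_polynomial_function (\<lambda>t. krylov (Z t) (K t) q $ k)" for q k
      by (rule real_polynomial_function_krylov) (simp_all add: Z_def K_def real_polynomial_function_line)
    show "max_dim col_space A S C F \<le> dim (case_sum (\<lambda>y. Z 1 *v y) (K 1) ` (UNIV <+> C))"
      unfolding dim_col_space_family by (simp add: Z_def K01 Y(3))
    show "rank X \<le> dim (krylov (Z 0) (K 0) ` (UNIV \<times> C))"
      using rank_le_krylov_if_controls_nonzero_modes[OF block_realization_symmetric[OF X(1)] G(2)]
      by (simp add: Z_def K01)
  qed
  then obtain t where t: "max_dim col_space A S C F \<le> dim (col_space (Z t) C (K t))"
      "rank X \<le> dim (krylov (Z t) (K t) ` (UNIV \<times> C))"
    unfolding dim_col_space_family by blast
  have "controls_nonzero_modes (Z t) C (K t)"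
    using X(2)[OF Z] t(2) order_trans
    by (intro controls_nonzero_modes_if_krylov block_realization_symmetric[OF Z]) blast
  then have "col_space (Z t) C (K t) \<subseteq> stabilizable_subspace (Z t) C (K t)"
    by (intro col_space_subset_stabilizable_subspace block_realization_symmetric[OF Z] \<open>finite C\<close>)
  then have "dim (col_space (Z t) C (K t)) \<le> dim (stabilizable_subspace (Z t) C (K t))"
    by (rule dim_subset)
  also have "\<dots> \<le> max_dim stabilizable_subspace A S C F"
    by (rule dim_le_max_dim[OF Z K])
  finally show "max_dim col_space A S C F \<le> max_dim stabilizable_subspace A S C F"
    using t(1) by simp
qed

lemma max_dim_col_space_mono:
  assumes "C \<subseteq> D"
  shows "max_dim col_space A S C F \<le> max_dim col_space A S D F"
proof -
  obtain X G where X: "block_realization A S X" "col_realization C F G"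
      "dim (col_space X C G) = max_dim col_space A S C F"
    by (rule max_dim_attained)
  let ?G = "\<lambda>j. if j \<in> C then G j else 0"
  have "col_space X C G \<subseteq> col_space X D ?G"
    unfolding col_space_def using assms by (intro span_mono) auto
  then have "dim (col_space X C G) \<le> dim (col_space X D ?G)"
    by (rule dim_subset)
  also have "\<dots> \<le> max_dim col_space A S D F"
    using X(1,2) by (intro dim_le_max_dim) (auto simp: col_realization_def)
  finally show ?thesis
    by (simp add: X(3))
qed

text \<open>One generic realization attains the maximum on both \<open>C \<union> D\<close> and \<open>C \<inter> D\<close>.\<close>

lemma max_dim_col_space_submodular:
  fixes A :: "entry ^ 'n ^ 'n"
  shows "max_dim col_space A S (C \<union> D) F + max_dim col_space A S (C \<inter> D) F
    \<le> max_dim col_space A S C F + max_dim col_space A S D F"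
proof -
  obtain X G where X: "block_realization A S X" "col_realization (C \<union> D) F G"
      "dim (col_space X (C \<union> D) G) = max_dim col_space A S (C \<union> D) F"
    by (rule max_dim_attained)
  obtain Y H' where Y: "block_realization A S Y" "col_realization (C \<inter> D) F H'"
      "dim (col_space Y (C \<inter> D) H') = max_dim col_space A S (C \<inter> D) F"
    by (rule max_dim_attained)
  \<comment> \<open>\<open>H'\<close> is constrained on \<open>C \<inter> D\<close> only; extension
    by zero makes it a realization on \<open>C \<union> D\<close>, so the whole line consists of
    realizations.\<close>
  define H where "H j = (if j \<in> C \<inter> D then H' j else 0)" for j
  have H: "col_realization (C \<union> D) F H"
    using Y(2) by (simp add: col_realization_def H_def)
  have dimH: "dim (col_space Y (C \<inter> D) H) = max_dim col_space A S (C \<inter> D) F"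
  proof -
    have "H ` (C \<inter> D) = H' ` (C \<inter> D)"
      by (rule image_cong) (auto simp: H_def)
    then show ?thesis
      using Y(3) by (simp only: col_space_def)
  qed
  define Z where "Z t = X + t *\<^sub>R (Y - X)" for t
  define K where "K t j = G j + t *\<^sub>R (H j - G j)" for t j
  have K01: "K 0 = G" "K 1 = H"
    by (simp_all add: K_def fun_eq_iff)
  have Z: "block_realization A S (Z t)" and K: "col_realization (C \<union> D) F (K t)" for t
    unfolding Z_def K_def by (intro block_realization_affine X Y col_realization_affine H)+
  have "\<exists>t. max_dim col_space A S (C \<union> D) F \<le> dim (case_sum (\<lambda>y. Z t *v y) (K t) ` (UNIV <+> (C \<union> D))) \<and>
      max_dim col_space A S (C \<inter> D) F \<le> dim (case_sum (\<lambda>y. Z t *v y) (K t) ` (UNIV <+> (C \<inter> D)))"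
  proof (rule common_generic_point)
    show "real_polynomial_function (\<lambda>t. case_sum (\<lambda>y. Z t *v y) (K t) q $ k)" for q k
      unfolding Z_def K_def by (rule real_polynomial_function_col_space_family)
    then show "real_polynomial_function (\<lambda>t. case_sum (\<lambda>y. Z t *v y) (K t) q $ k)" for q k .
    show "max_dim col_space A S (C \<union> D) F \<le> dim (case_sum (\<lambda>y. Z 0 *v y) (K 0) ` (UNIV <+> (C \<union> D)))"
      unfolding dim_col_space_family by (simp add: Z_def K01 X(3))
    show "max_dim col_space A S (C \<inter> D) F \<le> dim (case_sum (\<lambda>y. Z 1 *v y) (K 1) ` (UNIV <+> (C \<inter> D)))"
      unfolding dim_col_space_family by (simp add: Z_def K01 dimH)
  qed
  then obtain t where t: "max_dim col_space A S (C \<union> D) F \<le> dim (col_space (Z t) (C \<union> D) (K t))"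
      "max_dim col_space A S (C \<inter> D) F \<le> dim (col_space (Z t) (C \<inter> D) (K t))"
    unfolding dim_col_space_family by blast
  let ?V = "\<lambda>C. col_space (Z t) C (K t)"
  \<comment> \<open>For one fixed realization, submodularity is the dimension formula for the sum
    and intersection of two subspaces.\<close>
  have "?V (C \<union> D) \<subseteq> {x + y |x y. x \<in> ?V C \<and> y \<in> ?V D}"
  proof -
    have "?V (C \<union> D) = span ((range ((*v) (Z t)) \<union> K t ` C) \<union> (range ((*v) (Z t)) \<union> K t ` D))"
      unfolding col_space_def by (rule arg_cong[of _ _ span]) auto
    also have "\<dots> = {x + y |x y. x \<in> ?V C \<and> y \<in> ?V D}"
      unfolding col_space_def by (rule span_Un)
    finally show ?thesis
      by simp
  qed
  then have "dim (?V (C \<union> D)) \<le> dim {x + y |x y. x \<in> ?V C \<and> y \<in> ?V D}"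
    by (rule dim_subset)
  moreover have "?V (C \<inter> D) \<subseteq> ?V C \<inter> ?V D"
    unfolding col_space_def by (intro Int_greatest span_mono) auto
  then have "dim (?V (C \<inter> D)) \<le> dim (?V C \<inter> ?V D)"
    by (rule dim_subset)
  ultimately have "dim (?V (C \<union> D)) + dim (?V (C \<inter> D)) \<le> dim (?V C) + dim (?V D)"
    using dim_sums_Int[OF subspace_col_space[of "Z t" C "K t"] subspace_col_space[of "Z t" D "K t"]] by simp
  also have "\<dots> \<le> max_dim col_space A S C F + max_dim col_space A S D F"
    using K[of t] by (intro add_mono dim_le_max_dim Z) (auto simp: col_realization_def)
  finally show ?thesis
    using t by simp
qed

section \<open>Submodularity of the recovery objective\<close>

text \<open>For symmetric \<open>A\<close>, these are the unions of connected components of its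
  graph.\<close>

definition closed_set :: "entry ^ 'n ^ 'n \<Rightarrow> 'n set \<Rightarrow> bool" where
  "closed_set A T \<longleftrightarrow> separated A T (- T)"

definition unreached :: "entry ^ 'n ^ 'n \<Rightarrow> 'c set \<Rightarrow> ('c \<Rightarrow> entry ^ 'n) \<Rightarrow> 'n set" where
  "unreached A C F = \<Union>{T. closed_set A T \<and> T \<inter> input_rows C F = {}}"

text \<open>The number of generically nonzero modes on \<open>T\<close> that cannot be made stable without inputs.\<close>

definition deficit :: "entry ^ 'n ^ 'n \<Rightarrow> ('c \<Rightarrow> entry ^ 'n) \<Rightarrow> 'n set \<Rightarrow> int" where
  "deficit A F T = int (max_dim col_space A T {} F) - int (max_dim stabilizable_subspace A T {} F)"

lemma closed_set_Diff:
  assumes "symmetrically_structured A" "closed_set A S" "closed_set A T"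
  shows "closed_set A (S - T)"
  using assms separated_sym[OF assms(1), of T "- T"] unfolding closed_set_def separated_def by blast

lemma closed_set_Int: "closed_set A S \<Longrightarrow> closed_set A T \<Longrightarrow> closed_set A (S \<inter> T)"
  unfolding closed_set_def separated_def by blast

lemma closed_set_UNIV: "closed_set A UNIV"
  by (simp add: closed_set_def separated_def)

lemma closed_set_unreached: "closed_set A (unreached A C F)"
  unfolding unreached_def closed_set_def separated_def by blast

lemma unreached_disjoint: "unreached A C F \<inter> input_rows C F = {}"
  unfolding unreached_def by blast

lemma closed_set_subset_unreached: "closed_set A T \<Longrightarrow> T \<inter> input_rows C F = {} \<Longrightarrow> T \<subseteq> unreached A C F"
  unfolding unreached_def by blast

lemma input_rows_Un: "input_rows (C \<union> D) F = input_rows C F \<union> input_rows D F"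
  by (auto simp: input_rows_def)

lemma unreached_antimono: "C \<subseteq> D \<Longrightarrow> unreached A D F \<subseteq> unreached A C F"
  using closed_set_subset_unreached[OF closed_set_unreached, of A D F C F] unreached_disjoint[of A D F]
  by (auto simp: input_rows_def)

text \<open>Equality is special to unions. For \<open>C \<inter> D\<close> only an inclusion holds,
  since \<open>C\<close> and \<open>D\<close> may reach the same component through different
  columns.\<close>

lemma unreached_Un: "unreached A (C \<union> D) F = unreached A C F \<inter> unreached A D F"
proof (rule subset_antisym)
  show "unreached A (C \<union> D) F \<subseteq> unreached A C F \<inter> unreached A D F"
    by (simp add: unreached_antimono)
  show "unreached A C F \<inter> unreached A D F \<subseteq> unreached A (C \<union> D) F"
    using unreached_disjoint[of A C F] unreached_disjoint[of A D F]
    by (intro closed_set_subset_unreached closed_set_Int closed_set_unreached) (auto simp: input_rows_Un)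
qed

lemma deficit_nonneg: "deficit A F T \<ge> 0"
  unfolding deficit_def using max_dim_stabilizable_subspace_le[of A T "{}" F] by simp

lemma deficit_Diff:
  assumes A: "symmetrically_structured A" and "closed_set A S" "closed_set A T" "S \<subseteq> T"
  shows "deficit A F T = deficit A F S + deficit A F (T - S)"
proof -
  have "separated A S (T - S)"
    using assms(2) unfolding closed_set_def separated_def by blast
  moreover have "S \<union> (T - S) = T" "S \<inter> (T - S) = {}" "input_rows {} F \<subseteq> S"
    using assms(4) by (auto simp: input_rows_def)
  ultimately show ?thesis
    using max_dim_col_space_Un[OF A, of S "T - S" "{}" F]
      max_dim_stabilizable_subspace_Un[OF A, of S "T - S" "{}" F] by (simp add: deficit_def)
qed

lemma deficit_mono:
  assumes "symmetrically_structured A" "closed_set A S" "closed_set A T" "S \<subseteq> T"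
  shows "deficit A F S \<le> deficit A F T"
  using deficit_Diff[OF assms, of F] deficit_nonneg[of A F "T - S"] by simp

lemma deficit_Un:
  assumes A: "symmetrically_structured A" and S: "closed_set A S" and T: "closed_set A T"
  shows "deficit A F S + deficit A F T = deficit A F (S \<union> T) + deficit A F (S \<inter> T)"
proof -
  have "closed_set A (S \<union> T)"
    using S T unfolding closed_set_def separated_def by blast
  moreover have "S \<union> T - S = T - S \<inter> T"
    by blast
  ultimately show ?thesis
    using deficit_Diff[OF A S, of "S \<union> T" F] deficit_Diff[OF A closed_set_Int[OF S T] T, of F] by simp
qed

text \<open>Off the unreached part, the stabilizable and column space maxima agree; on it there are
  no inputs. Adding and subtracting the column space maximum of the unreached part completes the
  generic rank of the whole matrix and leaves the deficit.\<close>

theorem m_dim_eq: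
  assumes A: "symmetrically_structured A" and "finite C"
  shows "int (m_dim A C F) = int (max_dim col_space A UNIV C F) - deficit A F (unreached A C F)"
proof -
  let ?U = "unreached A C F"
  have "closed_set A (- ?U)"
    using closed_set_Diff[OF A closed_set_UNIV closed_set_unreached] by (simp add: Compl_eq_Diff_UNIV)
  then have sep: "separated A (- ?U) ?U"
    by (simp add: closed_set_def)
  have "input_rows C F \<subseteq> - ?U"
    using unreached_disjoint[of A C F] by blast
  note split = A sep _ this
  have "reachable_from A (- ?U) (input_rows C F)"
    unfolding reachable_from_def
  proof (intro allI impI notI)
    fix T assume T: "T \<subseteq> - ?U" "T \<noteq> {}" "separated A T (- ?U - T)" "T \<inter> input_rows C F = {}"
    have "closed_set A T"
      using T(1,3) sep unfolding closed_set_def separated_def by blast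
    then have "T \<subseteq> ?U"
      using T(4) by (rule closed_set_subset_unreached)
    then show False
      using T(1,2) by blast
  qed
  then have "max_dim stabilizable_subspace A (- ?U) C F = max_dim col_space A (- ?U) C F"
    by (rule max_dim_stabilizable_subspace_reachable[OF A \<open>finite C\<close>])
  then show ?thesis
    using max_dim_col_space_Un[OF split] max_dim_stabilizable_subspace_Un[OF split]
    by (simp add: m_dim_eq_max_dim deficit_def)
qed

theorem m_dim_mono:
  assumes A: "symmetrically_structured A" and "finite D" "C \<subseteq> D"
  shows "m_dim A C F \<le> m_dim A D F"
proof -
  have "deficit A F (unreached A D F) \<le> deficit A F (unreached A C F)"
    using assms by (intro deficit_mono closed_set_unreached unreached_antimono)
  then show ?thesis
    using m_dim_eq[OF A, of C F] m_dim_eq[OF A, of D F] max_dim_col_space_mono[of C D A UNIV F]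
      assms(2,3) finite_subset by fastforce
qed

text \<open>The deficit is modular on closed sets. Its argument is exact for
  \<open>C \<union> D\<close> and can only be too small for \<open>C \<inter> D\<close>, where
  monotonicity helps. So the deficit of the unreached part is supermodular, and subtracting it
  preserves submodularity.\<close>

theorem m_dim_submodular:
  assumes A: "symmetrically_structured A" and fin: "finite C" "finite D"
  shows "m_dim A (C \<union> D) F + m_dim A (C \<inter> D) F \<le> m_dim A C F + m_dim A D F"
proof -
  let ?u = "\<lambda>C. unreached A C F" and ?d = "\<lambda>C. deficit A F (unreached A C F)"
  have "closed_set A (?u C \<union> ?u D)"
    using closed_set_unreached[of A C F] closed_set_unreached[of A D F]
    unfolding closed_set_def separated_def by blast
  then have "deficit A F (?u C \<union> ?u D) \<le> ?d (C \<inter> D)"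
    using unreached_antimono[of "C \<inter> D" _ A F] by (intro deficit_mono A closed_set_unreached) auto
  then have "?d C + ?d D \<le> ?d (C \<union> D) + ?d (C \<inter> D)"
    using deficit_Un[OF A closed_set_unreached closed_set_unreached, of F C F D F] by (simp add: unreached_Un)
  then show ?thesis
    using m_dim_eq[OF A, of _ F] max_dim_col_space_submodular[of A UNIV C D F] fin
    by (smt (verit) finite_Int finite_Un of_nat_add of_nat_le_iff)
qed

section \<open>Greedy maximization of monotone submodular functions\<close>

text \<open>Diminishing returns: adding the elements of \<open>X\<close> one at a time, each gains
  at most what it would gain over \<open>J\<close> alone.\<close>

lemma submodular_sum_bound:
  fixes d :: "nat set \<Rightarrow> nat"
  assumes mono: "\<And>S T. T \<subseteq> V \<Longrightarrow> S \<subseteq> T \<Longrightarrow> d S \<le> d T"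
    and submod: "\<And>S T. S \<subseteq> V \<Longrightarrow> T \<subseteq> V \<Longrightarrow> d (S \<union> T) + d (S \<inter> T) \<le> d S + d T"
    and "finite X" "X \<subseteq> V" "J \<subseteq> V"
  shows "real (d (J \<union> X)) \<le> real (d J) + (\<Sum>x\<in>X. real (d (J \<union> {x})) - real (d J))"
  using assms(3,4)
proof (induction X rule: finite_induct)
  case (insert x X)
  have eq: "(J \<union> X) \<union> (J \<union> {x}) = J \<union> insert x X"
    by blast
  have "d (J \<union> insert x X) + d ((J \<union> X) \<inter> (J \<union> {x})) \<le> d (J \<union> X) + d (J \<union> {x})"
    using submod[of "J \<union> X" "J \<union> {x}"] insert.prems assms(5) unfolding eq by blast
  moreover have "d J \<le> d ((J \<union> X) \<inter> (J \<union> {x}))"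
    using insert.prems assms(5) by (intro mono) auto
  moreover have "real (d (J \<union> X)) \<le> real (d J) + (\<Sum>x\<in>X. real (d (J \<union> {x})) - real (d J))"
    using insert by simp
  ultimately show ?case
    using insert.hyps by simp
qed simp

lemma greedy_state_invariant:
  assumes "greedy_state d V i J L"
  shows "J \<subseteq> V" "L = V - J" "finite J" "card J = i"
  using assms by (induction rule: greedy_state.induct) auto

text \<open>The at most \<open>k\<close> elements of \<open>X\<close> together close the gap to
  \<open>d X\<close>, so the best single element closes at least a \<open>1/k\<close> fraction of
  it; each iteration shrinks the gap by the factor \<open>1 - 1/k\<close>.\<close>

lemma greedy_state_bound:
  fixes d :: "nat set \<Rightarrow> nat"
  assumes "greedy_state d V i J L" "finite V" "k > 0"
    and mono: "\<And>S T. T \<subseteq> V \<Longrightarrow> S \<subseteq> T \<Longrightarrow> d S \<le> d T"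
    and submod: "\<And>S T. S \<subseteq> V \<Longrightarrow> T \<subseteq> V \<Longrightarrow> d (S \<union> T) + d (S \<inter> T) \<le> d S + d T"
    and X: "X \<subseteq> V" "card X \<le> k"
  shows "real (d X) - real (d J) \<le> (1 - 1 / real k) ^ i * real (d X)"
  using assms(1)
proof (induction rule: greedy_state.induct)
  case init
  then show ?case
    by simp
next
  case (step i J L j)
  note inv = greedy_state_invariant[OF step.hyps(1)]
  have fin: "finite L" "finite X"
    using inv(2) \<open>finite V\<close> X(1) finite_subset by auto
  let ?g = "real (d (J \<union> {j})) - real (d J)"
  have jV: "J \<union> {j} \<subseteq> V"
    using inv step.hyps(2) by auto
  have g0: "?g \<ge> 0"
    using mono[OF jV, of J] by auto
  have gain: "real (d (J \<union> {x})) - real (d J) \<le> ?g" if "x \<in> X" for x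
  proof (cases "x \<in> J")
    case True
    then show ?thesis
      using g0 by (simp add: insert_absorb)
  next
    case False
    then have "d (J \<union> {x}) \<le> d (J \<union> {j})"
      unfolding step.hyps(3) using that X(1) inv(2) fin by (intro Max_ge) auto
    then show ?thesis
      by simp
  qed
  have "real (d X) \<le> real (d (J \<union> X))"
    using mono[of "J \<union> X" X] X(1) inv(1) by simp
  also have "\<dots> \<le> real (d J) + (\<Sum>x\<in>X. real (d (J \<union> {x})) - real (d J))"
    by (rule submodular_sum_bound[of V]) (use mono submod fin X(1) inv(1) in auto)
  also have "\<dots> \<le> real (d J) + real (card X) * ?g"
    using sum_mono[of X, OF gain] by simp
  also have "\<dots> \<le> real (d J) + real k * ?g"
    using X(2) g0 by (intro add_left_mono mult_right_mono) auto
  finally have "(real (d X) - real (d J)) / real k \<le> ?g"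
    using \<open>k > 0\<close> by (simp add: field_simps)
  then have "real (d X) - real (d (J \<union> {j})) \<le> (1 - 1 / real k) * (real (d X) - real (d J))"
    by (simp add: algebra_simps diff_divide_distrib)
  also have "\<dots> \<le> (1 - 1 / real k) * ((1 - 1 / real k) ^ i * real (d X))"
    using \<open>k > 0\<close> step.IH by (intro mult_left_mono) auto
  finally show ?case
    by simp
qed

theorem greedy_returns_approximation:
  fixes d :: "nat set \<Rightarrow> nat"
  assumes greedy: "greedy_returns d V k J" and "finite V"
    and mono: "\<And>S T. T \<subseteq> V \<Longrightarrow> S \<subseteq> T \<Longrightarrow> d S \<le> d T"
    and submod: "\<And>S T. S \<subseteq> V \<Longrightarrow> T \<subseteq> V \<Longrightarrow> d (S \<union> T) + d (S \<inter> T) \<le> d S + d T"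
    and X: "X \<subseteq> V" "card X \<le> k"
  shows "(1 - 1 / exp 1) * real (d X) \<le> real (d J)"
proof -
  obtain i L where st: "greedy_state d V i J L" and i: "i = k \<or> i < k \<and> L = {}"
    using greedy unfolding greedy_returns_def by blast
  note inv = greedy_state_invariant[OF st]
  show ?thesis
  \<comment> \<open>If the ground set is exhausted then \<open>J = V\<close>, and if
    \<open>k = 0\<close> then \<open>X\<close> is empty; either way \<open>X\<close> is contained in
    \<open>J\<close>. Otherwise exactly \<open>k\<close> iterations were made.\<close>
  proof (cases "L = {} \<or> k = 0")
    case True
    then have "X \<subseteq> J"
      using inv X \<open>finite V\<close> i finite_subset[OF X(1)] by auto
    then have "real (d X) \<le> real (d J)"
      using mono[OF inv(1)] by simp
    moreover have "(1 - 1 / exp 1) * real (d X) \<le> 1 * real (d X)"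
      by (intro mult_right_mono) auto
    ultimately show ?thesis
      by linarith
  next
    case False
    then have k: "i = k" "k > 0"
      using i by auto
    \<comment> \<open>The \<open>k\<close>-th power of this inequality produces the constant
      \<open>1 / exp 1\<close>.\<close>
    have "1 - 1 / real k \<le> exp (- (1 / real k))"
      using exp_ge_add_one_self[of "- (1 / real k)"] by simp
    then have "(1 - 1 / real k) ^ k \<le> exp (- (1 / real k)) ^ k"
      using k(2) by (intro power_mono) auto
    also have "\<dots> = 1 / exp 1"
      using k(2) by (simp add: exp_of_nat_mult[symmetric] exp_minus field_simps)
    finally have "(1 - 1 / real k) ^ k * real (d X) \<le> 1 / exp 1 * real (d X)"
      by (intro mult_right_mono) auto
    then show ?thesis
      using greedy_state_bound[OF st \<open>finite V\<close> k(2) mono submod X] k(1) by (simp add: algebra_simps)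
  qed
qed

theorem theorem6:
  fixes A :: "entry ^ 'n ^ 'n"
    and B Bcan :: "nat \<Rightarrow> entry ^ 'n"
    and m m' k :: nat
    and J :: "nat set"
  assumes "symmetrically_structured A"
    and "greedy_returns (recovery_dim A m B Bcan) {1..m'} k J"
  shows "J \<subseteq> {1..m'} \<and> card J \<le> k \<and>
    real (recovery_dim A m B Bcan J) \<ge>
      (1 - 1 / exp 1) *
        real (Max {recovery_dim A m B Bcan J' | J'. J' \<subseteq> {1..m'} \<and> card J' \<le> k})"
proof -
  let ?d = "recovery_dim A m B Bcan" and ?V = "{1..m'}"
  have mono: "?d S \<le> ?d T" if "T \<subseteq> ?V" "S \<subseteq> T" for S T
    unfolding recovery_dim_def using that finite_subset[of T ?V]
    by (intro m_dim_mono[OF assms(1)]) auto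
  have submod: "?d (S \<union> T) + ?d (S \<inter> T) \<le> ?d S + ?d T" if "S \<subseteq> ?V" "T \<subseteq> ?V" for S T
  proof -
    have "({1..m} <+> S) \<union> ({1..m} <+> T) = {1..m} <+> (S \<union> T)"
      "({1..m} <+> S) \<inter> ({1..m} <+> T) = {1..m} <+> (S \<inter> T)"
      by auto
    then show ?thesis
      unfolding recovery_dim_def
      using m_dim_submodular[OF assms(1), of "{1..m} <+> S" "{1..m} <+> T" "case_sum B Bcan"]
        that finite_subset[of _ ?V] by auto
  qed
  have "finite {?d X | X. X \<subseteq> ?V \<and> card X \<le> k}"
    by (rule finite_subset[of _ "?d ` Pow ?V"]) auto
  moreover have "?d {} \<in> {?d X | X. X \<subseteq> ?V \<and> card X \<le> k}"
    by force
  ultimately have "Max {?d X | X. X \<subseteq> ?V \<and> card X \<le> k} \<in> {?d X | X. X \<subseteq> ?V \<and> card X \<le> k}"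
    by (intro Max_in) blast+
  then obtain X where X: "X \<subseteq> ?V" "card X \<le> k" "Max {?d X | X. X \<subseteq> ?V \<and> card X \<le> k} = ?d X"
    by blast
  have "J \<subseteq> ?V \<and> card J \<le> k"
    using assms(2) greedy_state_invariant unfolding greedy_returns_def by fastforce
  then show ?thesis
    using greedy_returns_approximation[OF assms(2) _ mono submod X(1,2)] X(3) by simp
qed

end
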